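(* Let $1<p<\infty$ and $1/p+1/p^{*}=1$. Let $n\in\mathbb{N}$, let $X_1,\dots,X_n,Y$ be Banach spaces and let $T\in\mathcal{L}(X_1,\dots,X_n;Y)$ be a continuous $n$-linear operator. The following statements are equivalent: (i) there is a $C>0$ such that $$\sum_{i=1}^{m}|\varphi_i(T(x_i^{(1)},\dots,x_i^{(n)}))|\le C\Big(\sum_{i=1}^{m}\prod_{j=1}^{n}\|x_i^{(j)}\|^{p}\Big)^{1/p}\|(\varphi_i)_{i=1}^m\|_{w,p^{*}}$$ for all $m\in\mathbb{N}$, $x_i^{(j)}\in X_j$, $\varphi_i\in Y'$, $i=1,\dots,m$, $j=1,\dots,n$; (ii) there is a $C>0$ such that $$\sum_{i=1}^{m}|\varphi_i(T(x_i^{(1)},\dots,x_i^{(n)}))|\le C\prod_{j=1}^{n}\Big(\sum_{i=1}^{m}\|x_i^{(j)}\|^{np}\Big)^{1/(np)}\|(\varphi_i)_{i=1}^m\|_{w,p^{*}}$$ for all $m\in\mathbb{N}$, $x_i^{(j)}\in X_j$, $\varphi_i\in Y'$, $i=1,\dots,m$, $j=1,\dots,n$; (iii) there are a $C>0$ and a Borel probability measure $\mu$ on $B_{Y''}$ such that $$|\varphi(T(x_1,\dots,x_n))|\le C\|x_1\|\cdots\|x_n\|\Big(\int_{B_{Y''}}|\psi(\varphi)|^{p^{*}}\,d\mu(\psi)\Big)^{1/p^{*}}$$ for all $x_j\in X_j$, $j=1,\dots,n$, and $\varphi\in Y'$.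
   Context: Banach spaces are over $\mathbb{K}=\mathbb{R}$ or $\mathbb{C}$; $Y'$ and $Y''$ are the topological dual and bidual. $B_{Y''}$ is the closed unit ball of $Y''$ with the weak-star topology $\sigma(Y'',Y')$ (a compact Hausdorff space). For $\varphi_1,\dots,\varphi_m\in Y'$, $\|(\varphi_i)_{i=1}^m\|_{w,p^{*}}=\sup_{\psi\in B_{Y''}}\big(\sum_{i=1}^m|\psi(\varphi_i)|^{p^{*}}\big)^{1/p^{*}}=\sup_{y\in B_Y}\big(\sum_{i=1}^m|\varphi_i(y)|^{p^{*}}\big)^{1/p^{*}}$. *)

theory Defs
  imports "HOL-Probability.Probability" "HOL-Algebra.Module"
begin

text \<open>
  Normed spaces are given with explicit carriers, so that a family \<open>X\<^sub>1, \<dots>, X\<^sub>n\<close> of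
  unrelated spaces, with \<open>n\<close> an ordinary natural number, can be treated as a function
  \<open>nat \<Rightarrow> 'a normed_module\<close>. No relation between the operations of the different spaces is
  imposed; \<open>'a\<close> only supplies elements.

  The scalar field is a set \<open>K\<close> of complex numbers, meant to be \<open>\<real>\<close> or \<open>UNIV\<close>. Scalar
  multiplication by elements outside \<open>K\<close> is irrelevant, and so are the fields
  \<^term>\<open>monoid.mult\<close> and \<^term>\<open>monoid.one\<close>, which the library's record of modules inherits
  from the record of rings and which the locale of modules leaves unconstrained.
\<close>

record 'a normed_module = "(complex, 'a) module" +
  nrm :: "'a \<Rightarrow> real"

definition scalar_field :: "complex set \<Rightarrow> complex normed_module" where
  "scalar_field K =
     \<lparr>carrier = K, monoid.mult = (*), one = 1, ring.zero = 0, add = (+), smult = (*), nrm = cmod\<rparr>"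

text \<open>
  The distance is cut off outside the carrier because \<^locale>\<open>Metric_space\<close> demands
  nonnegativity and symmetry on the whole type.
\<close>

definition norm_dist :: "'a normed_module \<Rightarrow> 'a \<Rightarrow> 'a \<Rightarrow> real" where
  "norm_dist V x y = (if x \<in> carrier V \<and> y \<in> carrier V then nrm V (x \<ominus>\<^bsub>V\<^esub> y) else 0)"

definition norm_topology :: "'a normed_module \<Rightarrow> 'a topology" where
  "norm_topology V = Metric_space.mtopology (carrier V) (norm_dist V)"

locale normed_space = Module.module "scalar_field K" V
  for K :: "complex set" and V :: "'a normed_module" (structure) +
  assumes nrm_eq_zero_iff: "x \<in> carrier V \<Longrightarrow> nrm V x = 0 \<longleftrightarrow> x = \<zero>"
    and nrm_smult: "c \<in> K \<Longrightarrow> x \<in> carrier V \<Longrightarrow> nrm V (c \<odot> x) = cmod c * nrm V x"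
    and nrm_triangle:
      "x \<in> carrier V \<Longrightarrow> y \<in> carrier V \<Longrightarrow> nrm V (x \<oplus> y) \<le> nrm V x + nrm V y"

locale banach_space = normed_space +
  assumes complete: "Metric_space.mcomplete (carrier V) (norm_dist V)"

definition unit_ball :: "'a normed_module \<Rightarrow> 'a set" where
  "unit_ball V = {x \<in> carrier V. nrm V x \<le> 1}"

definition linear_map ::
    "complex set \<Rightarrow> 'a normed_module \<Rightarrow> 'b normed_module \<Rightarrow> ('a \<Rightarrow> 'b) \<Rightarrow> bool" where
  "linear_map K V W f \<longleftrightarrow>
     f \<in> carrier V \<rightarrow> carrier W \<and>
     (\<forall>x\<in>carrier V. \<forall>y\<in>carrier V. f (x \<oplus>\<^bsub>V\<^esub> y) = f x \<oplus>\<^bsub>W\<^esub> f y) \<and>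
     (\<forall>c\<in>K. \<forall>x\<in>carrier V. f (c \<odot>\<^bsub>V\<^esub> x) = c \<odot>\<^bsub>W\<^esub> f x)"

text \<open>
  The topological dual with the operator norm. Functionals are extensional functions, so that
  equality in the dual is equality on the carrier.
\<close>

definition dual :: "complex set \<Rightarrow> 'a normed_module \<Rightarrow> ('a \<Rightarrow> complex) normed_module" where
  "dual K V =
     \<lparr>carrier = {f \<in> extensional (carrier V). linear_map K V (scalar_field K) f \<and>
                   continuous_map (norm_topology V) (norm_topology (scalar_field K)) f},
      monoid.mult = undefined,
      one = undefined,
      ring.zero = (\<lambda>x\<in>carrier V. 0),
      add = (\<lambda>f g. \<lambda>x\<in>carrier V. f x + g x),
      smult = (\<lambda>c f. \<lambda>x\<in>carrier V. c * f x),
      nrm = (\<lambda>f. SUP x\<in>unit_ball V. cmod (f x))\<rparr>"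

text \<open>
  The weak-star topology on the dual of \<open>V\<close>, i.e. the topology of pointwise convergence on \<open>V\<close>,
  and its restriction to the closed unit ball. With \<open>V\<close> the dual of \<open>Y\<close> this is the ball of the
  bidual with \<open>\<sigma>(Y'',Y')\<close>.
\<close>

definition weak_star_topology :: "complex set \<Rightarrow> 'a normed_module \<Rightarrow> ('a \<Rightarrow> complex) topology" where
  "weak_star_topology K V =
     subtopology (product_topology (\<lambda>_. norm_topology (scalar_field K)) (carrier V))
       (carrier (dual K V))"

definition weak_star_ball :: "complex set \<Rightarrow> 'a normed_module \<Rightarrow> ('a \<Rightarrow> complex) topology" where
  "weak_star_ball K V = subtopology (weak_star_topology K V) (unit_ball (dual K V))"

definition borel_algebra :: "'a topology \<Rightarrow> 'a measure" where
  "borel_algebra S = sigma (topspace S) {U. openin S U}"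

definition continuous_multilinear ::
    "complex set \<Rightarrow> nat \<Rightarrow> (nat \<Rightarrow> 'a normed_module) \<Rightarrow> 'b normed_module
      \<Rightarrow> ((nat \<Rightarrow> 'a) \<Rightarrow> 'b) \<Rightarrow> bool" where
  "continuous_multilinear K n X Y T \<longleftrightarrow>
     (\<forall>x \<in> (\<Pi>\<^sub>E j\<in>{1..n}. carrier (X j)). \<forall>j\<in>{1..n}.
        linear_map K (X j) Y (\<lambda>v. T (x(j := v)))) \<and>
     continuous_map (product_topology (\<lambda>j. norm_topology (X j)) {1..n}) (norm_topology Y) T"

definition weak_norm ::
    "complex set \<Rightarrow> 'b normed_module \<Rightarrow> real \<Rightarrow> nat \<Rightarrow> (nat \<Rightarrow> 'b \<Rightarrow> complex) \<Rightarrow> real" where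
  "weak_norm K Y q m \<phi> =
     (SUP \<psi>\<in>unit_ball (dual K (dual K Y)). (\<Sum>i=1..m. cmod (\<psi> (\<phi> i)) powr q) powr (1 / q))"

end

theory Submission
  imports Defs
begin

text \<open>
  The two summing estimates differ only in how the norms of the arguments are balanced. Hoelder's
  inequality for \<open>n\<close> factors bounds the product form by the factorwise form. Conversely, multilinearity
  allows each \<open>n\<close>-tuple to be rescaled, without changing its image under \<open>T\<close>, so that all its entries
  have the same norm, and for such tuples both right-hand sides agree (\<open>balanced_rescaling\<close>).

  If \<open>T\<close> is dominated by an integral against a probability measure \<open>\<mu>\<close>, then the summing estimate follows
  from Hoelder's inequality with exponents \<open>p\<close> and \<open>q\<close>, because the integral of
  \<open>\<Sum>\<^sub>i |\<psi>(\<phi>\<^sub>i)|\<^sup>q\<close> is at most its supremum over the ball.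

  The remaining implication is a Pietsch domination argument. Inserting the weights
  \<open>|\<phi>\<^sub>i(T x\<^sub>i)|\<^sup>q\<^sup>-\<^sup>1\<close> into the summing estimate yields
  \<open>\<Sum>\<^sub>i |\<phi>\<^sub>i(T x\<^sub>i)|\<^sup>q \<le> C\<^sup>q sup\<^sub>\<psi> \<Sum>\<^sub>i |\<psi>(\<phi>\<^sub>i)|\<^sup>q\<close> for tuples whose
  norms have product at most one
  (\<open>product_summing_imp_power_estimate\<close>). Hence every finite sum of the functions
  \<open>\<psi> \<mapsto> C\<^sup>q |\<psi>(\<phi>)|\<^sup>q - |\<phi>(T x)|\<^sup>q\<close>, which are continuous on the weak-star compact ball of the bidual, is
  nonnegative somewhere, and positive multiples may be absorbed into \<open>\<phi>\<close>. So the cone generated by these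
  functions does not meet the functions that are negative everywhere, and separation gives a probability
  measure against which all of them have nonnegative integral
  (\<open>ex_borel_measure_nonneg_on_cone\<close>). That is the domination.

  The separating measure is found in two stages. The functional \<open>f \<mapsto> sup f\<close> on all bounded functions is
  sublinear and nonnegative on the cone, so some linear functional below it is nonnegative on the cone
  (\<open>ex_linear_le_sublinear_nonneg_on\<close>, from Zorn's lemma). It is a mean, i.e. integration against a
  finitely additive charge defined on all subsets. On a compact Hausdorff space such a
  charge \<open>\<nu>\<close> gives rise to a countably additive Borel measure with the same integrals of continuous
  functions (\<open>ex_borel_measure_representing_mean\<close>): the closed sets approximate open sets from
  inside and open sets approximate arbitrary sets from outside, and the result is an outer measure for which
  open sets are measurable in the sense of Caratheodory. Compactness enters through countable
  subadditivity, normality through the splitting of closed sets. Compactness of the bidual ball is the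
  theorem of Banach and Alaoglu (\<open>compact_weak_star_ball\<close>).
\<close>

section \<open>Linear functionals below a sublinear functional\<close>

definition sublinear :: "('v::real_vector \<Rightarrow> real) \<Rightarrow> bool" where
  "sublinear p \<longleftrightarrow>
     (\<forall>x y. p (x + y) \<le> p x + p y) \<and> (\<forall>c>0. \<forall>x. p (c *\<^sub>R x) = c * p x)"

text \<open>
  Scaling by \<open>inverse c\<close> turns the one-sided homogeneity into equality.
\<close>

lemma sublinearI:
  assumes add: "\<And>x y. p (x + y) \<le> p x + p y"
    and scale: "\<And>c x. 0 < c \<Longrightarrow> p (c *\<^sub>R x) \<le> c * p x"
  shows "sublinear p"
  unfolding sublinear_def
proof (intro conjI allI impI antisym)
  fix c :: real and x assume c: "0 < c"
  have "p x \<le> inverse c * p (c *\<^sub>R x)"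
    using scale[of "inverse c" "c *\<^sub>R x"] c by simp
  then show "c * p x \<le> p (c *\<^sub>R x)"
    using c by (simp add: field_simps)
qed (use add scale in auto)

lemma sublinear_zero: assumes "sublinear p" shows "p 0 = 0"
proof -
  have "p (2 *\<^sub>R 0) = 2 * p 0" using assms unfolding sublinear_def by (meson zero_less_numeral)
  then show ?thesis by simp
qed

lemma sublinear_neg: assumes "sublinear p" shows "- p (- x) \<le> p x"
proof -
  have "p (x + - x) \<le> p x + p (- x)" using assms unfolding sublinear_def by blast
  then show ?thesis using sublinear_zero[OF assms] by simp
qed

text \<open>
  All new sublinear functionals below are pointwise infima: over a chain, over the multiples of a
  direction, over the finite sums from a set. The index \<open>k\<close> is allowed to depend on the points, so that
  the three cases are instances of one lemma.
\<close>

lemma sublinear_INF: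
  assumes ne: "I \<noteq> {}"
    and bdd: "\<And>x. bdd_below ((\<lambda>i. F i x) ` I)"
    and add: "\<And>i j x y. i \<in> I \<Longrightarrow> j \<in> I \<Longrightarrow> \<exists>k\<in>I. F k (x + y) \<le> F i x + F j y"
    and scale: "\<And>i c x. i \<in> I \<Longrightarrow> 0 < c \<Longrightarrow> \<exists>k\<in>I. F k (c *\<^sub>R x) \<le> c * F i x"
  shows "sublinear (\<lambda>x. INF i\<in>I. F i x)"
proof (rule sublinearI)
  fix x y
  let ?u = "\<lambda>x. INF i\<in>I. F i x"
  have *: "?u (x + y) \<le> F i x + F j y" if ij: "i \<in> I" "j \<in> I" for i j
  proof -
    obtain k where k: "k \<in> I" "F k (x + y) \<le> F i x + F j y" using add[OF ij] by blast
    show ?thesis using cINF_lower[OF bdd k(1)] k(2) by (rule order_trans)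
  qed
  have "?u (x + y) - F j y \<le> ?u x" if "j \<in> I" for j
    using *[OF _ that] ne by (intro cINF_greatest) (auto simp: algebra_simps)
  then have "?u (x + y) - ?u x \<le> ?u y"
    using ne by (intro cINF_greatest) (auto simp: algebra_simps)
  then show "?u (x + y) \<le> ?u x + ?u y" by simp
next
  fix c :: real and x assume c: "0 < c"
  let ?u = "\<lambda>x. INF i\<in>I. F i x"
  have "?u (c *\<^sub>R x) \<le> c * F i x" if i: "i \<in> I" for i
  proof -
    obtain k where k: "k \<in> I" "F k (c *\<^sub>R x) \<le> c * F i x" using scale[OF i c] by blast
    show ?thesis using cINF_lower[OF bdd k(1)] k(2) by (rule order_trans)
  qed
  then have "?u (c *\<^sub>R x) / c \<le> ?u x"
    using ne c by (intro cINF_greatest) (auto simp: field_simps)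
  then show "?u (c *\<^sub>R x) \<le> c * ?u x" using c by (simp add: field_simps)
qed

text \<open>
  For fixed \<open>y\<close>, the functional \<open>x \<mapsto> inf {m (x + t y) - t m y | t \<ge> 0}\<close> is sublinear and below \<open>m\<close>, hence equal
  to \<open>m\<close>. The value at \<open>t = 1\<close> gives \<open>m x + m y \<le> m (x + y)\<close>.
\<close>

lemma minimal_sublinear_linear:
  fixes m :: "'v::real_vector \<Rightarrow> real"
  assumes m: "sublinear m" and min: "\<And>r. sublinear r \<Longrightarrow> r \<le> m \<Longrightarrow> r = m"
  shows "linear m"
proof -
  have add: "m (x + y) = m x + m y" for x y
  proof (rule antisym)
    show "m (x + y) \<le> m x + m y" using m by (auto simp: sublinear_def)
    let ?F = "\<lambda>t x. m (x + t *\<^sub>R y) - t * m y"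
    have my: "m (t *\<^sub>R y) = t * m y" if "t \<in> {0..}" for t
      using m that sublinear_zero[OF m] by (cases "t = 0") (auto simp: sublinear_def)
    have low: "- m (- x) \<le> ?F t x" if "t \<in> {0..}" for t x
    proof -
      have "m (t *\<^sub>R y) \<le> m (x + t *\<^sub>R y) + m (- x)"
        using m unfolding sublinear_def by (metis add.commute add_minus_cancel)
      then show ?thesis using my[OF that] by simp
    qed
    have "sublinear (\<lambda>x. INF t\<in>{0..}. ?F t x)"
    proof (rule sublinear_INF)
      show "bdd_below ((\<lambda>t. ?F t x) ` {0..})" for x
        using low by (intro bdd_belowI2) blast
      show "\<exists>k\<in>{0..}. ?F k (x + x') \<le> ?F t x + ?F t' x'" if "t \<in> {0..}" "t' \<in> {0..}" for t t' x x'
      proof (rule bexI)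
        have "m ((x + t *\<^sub>R y) + (x' + t' *\<^sub>R y)) \<le> m (x + t *\<^sub>R y) + m (x' + t' *\<^sub>R y)"
          using m by (auto simp: sublinear_def)
        then show "?F (t + t') (x + x') \<le> ?F t x + ?F t' x'"
          by (simp add: algebra_simps)
      qed (use that in auto)
      show "\<exists>k\<in>{0..}. ?F k (c *\<^sub>R x) \<le> c * ?F t x" if "t \<in> {0..}" "0 < c" for t c x
      proof (rule bexI)
        have "m (c *\<^sub>R (x + t *\<^sub>R y)) = c * m (x + t *\<^sub>R y)"
          using m that by (auto simp: sublinear_def)
        then show "?F (c * t) (c *\<^sub>R x) \<le> c * ?F t x"
          by (simp add: algebra_simps)
      qed (use that in auto)
    qed auto
    moreover have bdd: "bdd_below ((\<lambda>t. ?F t x) ` {0..})" for x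
      using low by (intro bdd_belowI2) blast
    moreover have "(\<lambda>x. INF t\<in>{0..}. ?F t x) \<le> m"
    proof (rule le_funI)
      show "(INF t\<in>{0..}. ?F t x) \<le> m x" for x
        using cINF_lower[OF bdd, of 0 x] by simp
    qed
    ultimately have "(\<lambda>x. INF t\<in>{0..}. ?F t x) = m" using min by blast
    from fun_cong[OF this, of x] have "m x = (INF t\<in>{0..}. ?F t x)" by simp
    also have "\<dots> \<le> ?F 1 x" by (rule cINF_lower[OF bdd]) auto
    finally show "m x + m y \<le> m (x + y)" by simp
  qed
  have neg: "m (- x) = - m x" for x
    using add[of x "- x"] sublinear_zero[OF m] by simp
  have "m (c *\<^sub>R x) = c * m x" for c x
  proof (cases "c > 0 \<or> c = 0")
    case True then show ?thesis using m sublinear_zero[OF m] by (auto simp: sublinear_def)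
  next
    case False
    then have "0 < - c" by simp
    with m have "m ((- c) *\<^sub>R x) = (- c) * m x" unfolding sublinear_def by blast
    then show ?thesis using neg[of "c *\<^sub>R x"] by simp
  qed
  then show ?thesis using add by (intro linearI) auto
qed

text \<open>
  Zorn's lemma yields a minimal sublinear functional below \<open>p\<close>, since the sublinear functionals below \<open>p\<close>
  are bounded below pointwise by \<open>x \<mapsto> - p (- x)\<close> and so chains have infima.
\<close>

lemma ex_linear_le_sublinear:
  fixes p :: "'v::real_vector \<Rightarrow> real"
  assumes p: "sublinear p"
  shows "\<exists>L. linear L \<and> L \<le> p"
proof -
  let ?A = "{r. sublinear r \<and> r \<le> p}"
  let ?P = "\<lambda>r s :: 'v \<Rightarrow> real. s \<le> r"
  \<comment> \<open>The order is reversed, so that maximal elements are minimal functionals.\<close>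
  have "\<exists>m\<in>?A. \<forall>a\<in>?A. ?P m a \<longrightarrow> a = m"
  proof (rule predicate_Zorn)
    show "partial_order_on ?A (relation_of ?P ?A)"
      by (rule partial_order_on_relation_ofI) auto
    fix C assume C: "C \<in> Chains (relation_of ?P ?A)"
    then have CA: "C \<subseteq> ?A" and tot: "\<And>r s. r \<in> C \<Longrightarrow> s \<in> C \<Longrightarrow> r \<le> s \<or> s \<le> r"
      by (auto simp: Chains_def relation_of_def)
    show "\<exists>u\<in>?A. \<forall>a\<in>C. ?P a u"
    proof (cases "C = {}")
      case True then show ?thesis using p by auto
    next
      case False
      have low: "- p (- x) \<le> r x" if "r \<in> C" for r x
      proof -
        have "sublinear r" "r (- x) \<le> p (- x)" using that CA by (auto simp: le_fun_def)
        then show ?thesis using sublinear_neg[of r x] by linarith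
      qed
      have bdd: "bdd_below ((\<lambda>r. r x) ` C)" for x
        using low by (intro bdd_belowI2) blast
      have "sublinear (\<lambda>x. INF r\<in>C. r x)"
      proof (rule sublinear_INF[OF False bdd])
        fix r s x y assume rs: "r \<in> C" "s \<in> C"
        then obtain k where k: "k \<in> C" "k \<le> r" "k \<le> s" using tot by blast
        then have "k (x + y) \<le> k x + k y" using CA by (auto simp: sublinear_def)
        also have "\<dots> \<le> r x + s y" using k by (intro add_mono) (auto simp: le_fun_def)
        finally show "\<exists>k\<in>C. k (x + y) \<le> r x + s y" using k by blast
      next
        fix r :: "'v \<Rightarrow> real" and c :: real and x assume r: "r \<in> C" and c: "0 < c"
        have "r (c *\<^sub>R x) = c * r x" using r c CA by (auto simp: sublinear_def)
        then show "\<exists>k\<in>C. k (c *\<^sub>R x) \<le> c * r x" using r by (intro bexI[of _ r]) auto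
      qed
      moreover have le: "(\<lambda>x. INF r\<in>C. r x) \<le> r" if "r \<in> C" for r
        using bdd that by (auto simp: le_fun_def intro!: cINF_lower)
      moreover have "(\<lambda>x. INF r\<in>C. r x) \<le> p"
      proof -
        obtain r where "r \<in> C" using False by blast
        then show ?thesis using le[of r] CA by (blast intro: order_trans)
      qed
      ultimately show ?thesis by blast
    qed
  qed
  then obtain m where "sublinear m" "m \<le> p" "\<And>r. sublinear r \<Longrightarrow> r \<le> p \<Longrightarrow> r \<le> m \<Longrightarrow> r = m"
    by blast
  then show ?thesis using minimal_sublinear_linear[of m] by (blast intro: order_trans)
qed

text \<open>
  A separation theorem in analytic form: the infimum of \<open>p (x + s)\<close> over the finite sums \<open>s\<close> from \<open>H\<close> is still a
  sublinear functional, and any linear functional \<open>L\<close> below it satisfies \<open>L (- h) \<le> p (- h + h) = 0\<close>.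
\<close>

lemma ex_linear_le_sublinear_nonneg_on:
  fixes p :: "'v::real_vector \<Rightarrow> real"
  assumes p: "sublinear p"
    and scale: "\<And>c h. 0 < c \<Longrightarrow> h \<in> H \<Longrightarrow> c *\<^sub>R h \<in> H"
    and nonneg: "\<And>hs. hs \<in> lists H \<Longrightarrow> 0 \<le> p (sum_list hs)"
  shows "\<exists>L. linear L \<and> L \<le> p \<and> (\<forall>h\<in>H. 0 \<le> L h)"
proof -
  let ?F = "\<lambda>hs x. p (x + sum_list hs)"
  have low: "- p (- x) \<le> ?F hs x" if "hs \<in> lists H" for hs x
  proof -
    have "p (sum_list hs) \<le> p (x + sum_list hs) + p (- x)"
      using p unfolding sublinear_def by (metis add.commute add_minus_cancel)
    then show ?thesis using nonneg[OF that] by linarith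
  qed
  have bdd: "bdd_below ((\<lambda>hs. ?F hs x) ` lists H)" for x
    using low by (intro bdd_belowI2) blast
  have "sublinear (\<lambda>x. INF hs\<in>lists H. ?F hs x)"
  proof (rule sublinear_INF[OF _ bdd])
    show "lists H \<noteq> {}" by auto
    show "\<exists>k\<in>lists H. ?F k (x + y) \<le> ?F i x + ?F j y" if "i \<in> lists H" "j \<in> lists H" for i j x y
    proof (rule bexI)
      have "p ((x + sum_list i) + (y + sum_list j)) \<le> ?F i x + ?F j y"
        using p by (auto simp: sublinear_def)
      then show "?F (i @ j) (x + y) \<le> ?F i x + ?F j y" by (simp add: algebra_simps)
    qed (use that in auto)
    show "\<exists>k\<in>lists H. ?F k (c *\<^sub>R x) \<le> c * ?F hs x" if hs: "hs \<in> lists H" and c: "0 < c" for hs c x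
    proof (rule bexI)
      have s: "sum_list (map ((*\<^sub>R) c) hs) = c *\<^sub>R sum_list hs"
        by (induction hs) (auto simp: algebra_simps)
      have "p (c *\<^sub>R (x + sum_list hs)) = c * ?F hs x"
        using p c by (auto simp: sublinear_def)
      then show "?F (map ((*\<^sub>R) c) hs) (c *\<^sub>R x) \<le> c * ?F hs x"
        unfolding s by (simp add: algebra_simps)
    qed (use hs c scale in auto)
  qed
  then obtain L where L: "linear L" "\<And>x. L x \<le> (INF hs\<in>lists H. ?F hs x)"
    using ex_linear_le_sublinear by (fastforce simp: le_fun_def)
  have LF: "L x \<le> ?F hs x" if "hs \<in> lists H" for hs x
    using L(2) cINF_lower[OF bdd that] by (rule order_trans)
  have "L \<le> p" using LF[of "[]"] by (auto simp: le_fun_def)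
  moreover have "0 \<le> L h" if "h \<in> H" for h
    using LF[of "[h]" "- h"] that linear_neg[OF L(1), of h] sublinear_zero[OF p] by auto
  ultimately show ?thesis using L(1) by blast
qed

section \<open>From finitely additive charges to Borel measures on compact spaces\<close>

text \<open>
  A finitely additive charge on all subsets is what a mean on the bounded functions provides. Its link with the
  topology is created by \<open>inner\<close> and \<open>outer\<close>, which regularize it to a countably additive measure.
\<close>

locale compact_charge =
  fixes S :: "'c topology" and \<nu> :: "'c set \<Rightarrow> real"
  assumes compact: "compact_space S"
    and Hausdorff: "Hausdorff_space S"
    and nonneg: "A \<subseteq> topspace S \<Longrightarrow> 0 \<le> \<nu> A"
    and additive: "A \<subseteq> topspace S \<Longrightarrow> B \<subseteq> topspace S \<Longrightarrow> A \<inter> B = {} \<Longrightarrow> \<nu> (A \<union> B) = \<nu> A + \<nu> B"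
begin

definition inner :: "'c set \<Rightarrow> ennreal" where
  "inner U = (SUP F\<in>{F. closedin S F \<and> F \<subseteq> U}. ennreal (\<nu> F))"

definition outer :: "'c set \<Rightarrow> ennreal" where
  "outer A = (INF U\<in>{U. openin S U \<and> A \<subseteq> U}. inner U)"

lemma charge_empty: "\<nu> {} = 0"
  using additive[of "{}" "{}"] by simp

lemma charge_mono: assumes "A \<subseteq> B" "B \<subseteq> topspace S" shows "\<nu> A \<le> \<nu> B"
proof -
  have "\<nu> (A \<union> (B - A)) = \<nu> A + \<nu> (B - A)" using assms by (intro additive) auto
  moreover have "A \<union> (B - A) = B" using assms by auto
  moreover have "0 \<le> \<nu> (B - A)" using assms by (intro nonneg) auto
  ultimately show ?thesis by simp
qed

lemma charge_subadditive:
  assumes "A \<subseteq> topspace S" "B \<subseteq> topspace S" shows "\<nu> (A \<union> B) \<le> \<nu> A + \<nu> B"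
proof -
  have "\<nu> (A \<union> (B - A)) = \<nu> A + \<nu> (B - A)" using assms by (intro additive) auto
  moreover have "\<nu> (B - A) \<le> \<nu> B" using assms by (intro charge_mono) auto
  ultimately show ?thesis by simp
qed

text \<open>
  The closed sets \<open>F - U\<close> and \<open>F - V\<close> are disjoint; removing disjoint open neighbourhoods of them, which exist by
  normality, leaves the two parts.
\<close>

lemma closed_split:
  assumes F: "closedin S F" "F \<subseteq> U \<union> V" and UV: "openin S U" "openin S V"
  obtains F1 F2 where "closedin S F1" "closedin S F2" "F1 \<subseteq> U" "F2 \<subseteq> V" "F = F1 \<union> F2"
proof -
  have "normal_space S"
    using compact Hausdorff by (simp add: compact_Hausdorff_or_regular_imp_normal_space)
  moreover have "closedin S (F - U)" "closedin S (F - V)" "disjnt (F - U) (F - V)"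
    using assms by (auto simp: closedin_diff disjnt_def)
  ultimately obtain W1 W2 where W: "openin S W1" "openin S W2" "F - U \<subseteq> W1" "F - V \<subseteq> W2" "disjnt W1 W2"
    unfolding normal_space_def by metis
  show thesis
  proof (rule that[of "F - W1" "F - W2"])
    show "closedin S (F - W1)" "closedin S (F - W2)" using F W by (auto simp: closedin_diff)
  qed (use W in \<open>auto simp: disjnt_def\<close>)
qed

lemma charge_le_inner: "closedin S F \<Longrightarrow> F \<subseteq> U \<Longrightarrow> ennreal (\<nu> F) \<le> inner U"
  unfolding inner_def by (intro SUP_upper) auto

lemma inner_mono: "U \<subseteq> V \<Longrightarrow> inner U \<le> inner V"
  unfolding inner_def by (intro SUP_subset_mono) auto

lemma inner_le_charge: "U \<subseteq> topspace S \<Longrightarrow> inner U \<le> ennreal (\<nu> U)"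
  unfolding inner_def by (intro SUP_least ennreal_leI charge_mono) auto

lemma charge_le_sum_inner:
  assumes "finite I" "closedin S F" "F \<subseteq> (\<Union>i\<in>I. U i)" "\<And>i. i \<in> I \<Longrightarrow> openin S (U i)"
  shows "ennreal (\<nu> F) \<le> (\<Sum>i\<in>I. inner (U i))"
  using assms
proof (induction I arbitrary: F rule: finite_induct)
  case empty
  then show ?case by (simp add: charge_empty)
next
  case (insert a I)
  have cover: "F \<subseteq> U a \<union> (\<Union>i\<in>I. U i)" "openin S (U a)" "openin S (\<Union>i\<in>I. U i)"
    using insert.prems by auto
  obtain F1 F2 where F: "closedin S F1" "closedin S F2"
    "F1 \<subseteq> U a" "F2 \<subseteq> (\<Union>i\<in>I. U i)" "F = F1 \<union> F2"
    using closed_split[OF insert.prems(1) cover] by metis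
  have sub: "F1 \<subseteq> topspace S" "F2 \<subseteq> topspace S" using closedin_subset[OF F(1)] closedin_subset[OF F(2)] by auto
  have "ennreal (\<nu> F) \<le> ennreal (\<nu> F1 + \<nu> F2)"
    unfolding F(5) using sub by (intro ennreal_leI charge_subadditive)
  also have "\<dots> = ennreal (\<nu> F1) + ennreal (\<nu> F2)"
    using sub nonneg by (simp add: ennreal_plus)
  also have "\<dots> \<le> inner (U a) + (\<Sum>i\<in>I. inner (U i))"
    using F insert.prems by (intro add_mono charge_le_inner insert.IH) auto
  finally show ?case using insert.hyps by simp
qed

text \<open>
  Closed subsets of the union are compact, so finitely many of the open sets suffice for each of them.
\<close>

lemma inner_countably_subadditive:
  fixes U :: "nat \<Rightarrow> 'c set"
  assumes "\<And>i. openin S (U i)"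
  shows "inner (\<Union>i. U i) \<le> (\<Sum>i. inner (U i))"
  unfolding inner_def[of "\<Union>i. U i"]
proof (intro SUP_least)
  fix F assume "F \<in> {F. closedin S F \<and> F \<subseteq> (\<Union>i. U i)}"
  then have F: "closedin S F" "F \<subseteq> \<Union> (range U)" by auto
  have "compactin S F" using compact F closedin_compact_space by blast
  then obtain \<U> where "finite \<U>" "\<U> \<subseteq> range U" "F \<subseteq> \<Union>\<U>"
    using F(2) assms unfolding compactin_def by (metis (no_types, lifting) imageE)
  then obtain I where I: "finite I" "\<U> = U ` I" by (meson finite_subset_image subset_UNIV)
  have "ennreal (\<nu> F) \<le> (\<Sum>i\<in>I. inner (U i))"
    using F I \<open>F \<subseteq> \<Union>\<U>\<close> assms by (intro charge_le_sum_inner) auto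
  also have "\<dots> \<le> (\<Sum>i. inner (U i))" using I by (intro sum_le_suminf) auto
  finally show "ennreal (\<nu> F) \<le> (\<Sum>i. inner (U i))" .
qed

lemma outer_open: "openin S U \<Longrightarrow> outer U = inner U"
  unfolding outer_def by (intro antisym INF_lower INF_greatest inner_mono) auto

lemma outer_mono: "A \<subseteq> B \<Longrightarrow> outer A \<le> outer B"
  unfolding outer_def by (intro INF_superset_mono) auto

lemma outer_close:
  assumes "outer A < e"
  obtains U where "openin S U" "A \<subseteq> U" "inner U < e"
  using assms unfolding outer_def INF_less_iff by auto

lemma outer_countably_subadditive:
  fixes A :: "nat \<Rightarrow> 'c set"
  shows "outer (\<Union>i. A i) \<le> (\<Sum>i. outer (A i))"
proof (rule ennreal_le_epsilon)
  fix e :: real assume e: "0 < e" and fin: "(\<Sum>i. outer (A i)) < Orderings.top"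
  have "outer (A n) < outer (A n) + e * (1/2) ^ Suc n" for n
    using e fin by (auto simp add: less_top dest!: ennreal_suminf_lessD)
  then have "\<exists>U. openin S U \<and> A n \<subseteq> U \<and> inner U \<le> outer (A n) + e * (1/2) ^ Suc n" for n
    by (metis outer_close less_imp_le)
  then obtain U where U: "\<And>n. openin S (U n)" "\<And>n. A n \<subseteq> U n"
    "\<And>n. inner (U n) \<le> outer (A n) + e * (1/2) ^ Suc n"
    by metis
  have "outer (\<Union>i. A i) \<le> outer (\<Union>i. U i)" using U(2) by (intro outer_mono) blast
  also have "\<dots> = inner (\<Union>i. U i)" using U(1) by (intro outer_open) auto
  also have "\<dots> \<le> (\<Sum>i. inner (U i))" using U(1) by (rule inner_countably_subadditive)
  also have "\<dots> \<le> (\<Sum>n. outer (A n) + e * (1/2) ^ Suc n)" using U(3) by (intro suminf_le) auto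
  also have "\<dots> = (\<Sum>n. outer (A n)) + (\<Sum>n. ennreal e * ennreal ((1/2) ^ Suc n))"
    using e by (subst suminf_add[symmetric])
               (auto simp del: ennreal_suminf_cmult simp add: ennreal_mult[symmetric])
  also have "\<dots> = (\<Sum>n. outer (A n)) + e"
    unfolding ennreal_suminf_cmult
    by (subst suminf_ennreal_eq[OF zero_le_power power_half_series]) auto
  finally show "outer (\<Union>i. A i) \<le> (\<Sum>n. outer (A n)) + e" .
qed

lemma outer_empty: "outer {} = 0"
  using inner_le_charge[of "{}"] by (simp add: outer_open charge_empty)

lemma outer_measure_space_outer: "outer_measure_space (Pow (topspace S)) outer"
  unfolding outer_measure_space_def positive_def increasing_def countably_subadditive_def
  using outer_empty outer_mono outer_countably_subadditive by auto

text \<open>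
  Exhaust \<open>V \<inter> U\<close> by a closed set \<open>F\<close> and then the open set \<open>V - F\<close>, which contains \<open>V - U\<close>, by a closed set \<open>G\<close>.
  The two are disjoint, so \<open>\<nu>\<close> is additive on them.
\<close>

lemma inner_superadditive_open:
  assumes U: "openin S U" and V: "openin S V"
  shows "outer (V \<inter> U) + outer (V - U) \<le> inner V"
proof -
  have VU: "outer (V \<inter> U) = inner (V \<inter> U)" using U V by (intro outer_open) auto
  have "ennreal (\<nu> F) + outer (V - U) \<le> inner V" if F: "closedin S F" "F \<subseteq> V \<inter> U" for F
  proof -
    have FV: "openin S (V - F)" using V F(1) by auto
    have sub: "F \<subseteq> topspace S" using closedin_subset[OF F(1)] .
    have "outer (V - U) \<le> outer (V - F)" using F by (intro outer_mono) auto
    also have "\<dots> = inner (V - F)" using FV by (rule outer_open)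
    finally have "ennreal (\<nu> F) + outer (V - U) \<le> ennreal (\<nu> F) + inner (V - F)"
      by (intro add_left_mono)
    also have "\<dots> = (SUP G\<in>{G. closedin S G \<and> G \<subseteq> V - F}. ennreal (\<nu> F) + ennreal (\<nu> G))"
      unfolding inner_def[of "V - F"]
      by (intro ennreal_SUP_add_right) (auto intro: exI[of _ "{}"])
    also have "\<dots> \<le> inner V"
    proof (intro SUP_least)
      fix G assume "G \<in> {G. closedin S G \<and> G \<subseteq> V - F}"
      then have G: "closedin S G" "G \<subseteq> V - F" "G \<subseteq> topspace S" by (auto dest: closedin_subset)
      have "ennreal (\<nu> F) + ennreal (\<nu> G) = ennreal (\<nu> (F \<union> G))"
        using G sub nonneg by (subst additive) (auto simp: ennreal_plus)
      also have "\<dots> \<le> inner V" using F G by (intro charge_le_inner) auto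
      finally show "ennreal (\<nu> F) + ennreal (\<nu> G) \<le> inner V" .
    qed
    finally show ?thesis .
  qed
  then have "(SUP F\<in>{F. closedin S F \<and> F \<subseteq> V \<inter> U}. ennreal (\<nu> F) + outer (V - U)) \<le> inner V"
    by (intro SUP_least) auto
  moreover have "(SUP F\<in>{F. closedin S F \<and> F \<subseteq> V \<inter> U}. ennreal (\<nu> F) + outer (V - U))
      = inner (V \<inter> U) + outer (V - U)"
    unfolding inner_def[of "V \<inter> U"] by (intro ennreal_SUP_add_left) (auto intro: exI[of _ "{}"])
  ultimately show ?thesis unfolding VU by (simp only:)
qed

lemma open_in_lambda_system:
  assumes U: "openin S U"
  shows "U \<in> lambda_system (topspace S) (Pow (topspace S)) outer"
proof -
  have "outer (A \<inter> U) + outer (A - U) = outer A" for A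
  proof (rule antisym)
    show "outer (A \<inter> U) + outer (A - U) \<le> outer A"
      unfolding outer_def[of A]
    proof (intro INF_greatest)
      fix V assume "V \<in> {V. openin S V \<and> A \<subseteq> V}"
      then have V: "openin S V" "A \<subseteq> V" by auto
      have "outer (A \<inter> U) + outer (A - U) \<le> outer (V \<inter> U) + outer (V - U)"
        using V by (intro add_mono outer_mono) auto
      also have "\<dots> \<le> inner V" using U V by (intro inner_superadditive_open)
      finally show "outer (A \<inter> U) + outer (A - U) \<le> inner V" .
    qed
    let ?B = "\<lambda>i::nat. if i = 0 then A \<inter> U else if i = 1 then A - U else {}"
    have "outer A \<le> outer (\<Union>i. ?B i)" by (intro outer_mono) (auto split: if_splits)
    also have "\<dots> \<le> (\<Sum>i. outer (?B i))" by (rule outer_countably_subadditive)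
    also have "\<dots> = (\<Sum>i\<in>{0,1}. outer (?B i))" by (intro suminf_finite) (auto simp: outer_empty)
    finally show "outer A \<le> outer (A \<inter> U) + outer (A - U)" by simp
  qed
  then show ?thesis
    using openin_subset[OF U] algebra.lambda_system_eq[of "topspace S" "Pow (topspace S)" outer]
    by (auto simp: algebra_Pow)
qed

text \<open>
  Passing to \<open>inner\<close> can only decrease the charge of open sets, so by complementation it can only increase
  the charge of closed ones.
\<close>

lemma ex_borel_measure_ge_charge_on_closed:
  assumes total: "\<nu> (topspace S) = 1"
  obtains \<mu> where "prob_space \<mu>" "sets \<mu> = sets (borel_algebra S)"
    "\<And>C. closedin S C \<Longrightarrow> \<nu> C \<le> measure \<mu> C"
proof -
  let ?L = "lambda_system (topspace S) (Pow (topspace S)) outer"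
  let ?B = "sigma_sets (topspace S) {U. openin S U}"
  have opens: "{U. openin S U} \<subseteq> Pow (topspace S)" by (auto dest: openin_subset)
  interpret P: sigma_algebra "topspace S" "Pow (topspace S)" by (rule sigma_algebra_Pow)
  have L: "measure_space (topspace S) ?L outer"
    by (rule P.caratheodory_lemma[OF outer_measure_space_outer])
  have BL: "?B \<subseteq> ?L"
    using L open_in_lambda_system
    by (intro sigma_algebra.sigma_sets_subset) (auto simp: measure_space_def)
  have ms: "measure_space (topspace S) ?B outer"
    using L BL by (intro measure_down[OF L] sigma_algebra_sigma_sets opens)
  define \<mu> where "\<mu> = measure_of (topspace S) {U. openin S U} outer"
  have sets: "sets \<mu> = ?B" and space: "space \<mu> = topspace S"
    using opens by (simp_all add: \<mu>_def)
  have em: "emeasure \<mu> A = outer A" if "A \<in> ?B" for A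
    using ms sets that by (intro emeasure_measure_of[OF \<mu>_def opens]) (auto simp: measure_space_def)
  have top: "topspace S \<in> ?B" by (rule sigma_sets_top)
  have "ennreal 1 \<le> inner (topspace S)"
    using charge_le_inner[of "topspace S" "topspace S"] total by simp
  moreover have "inner (topspace S) \<le> ennreal 1" using inner_le_charge[of "topspace S"] total by simp
  ultimately have inner1: "inner (topspace S) = 1" by simp
  then have "emeasure \<mu> (space \<mu>) = 1" using em[OF top] space by (simp add: outer_open)
  then interpret \<mu>: prob_space \<mu> by (rule prob_spaceI)
  show thesis
  proof (rule that[of \<mu>])
    show "prob_space \<mu>" by unfold_locales
    show "sets \<mu> = sets (borel_algebra S)" using sets opens by (simp add: borel_algebra_def)
    fix C assume C: "closedin S C"
    then have U: "openin S (topspace S - C)" by auto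
    then have UB: "topspace S - C \<in> sets \<mu>" using sets by auto
    have sub: "C \<subseteq> topspace S" using closedin_subset[OF C] .
    have "ennreal (measure \<mu> (topspace S - C)) = outer (topspace S - C)"
      using em UB sets by (simp add: \<mu>.emeasure_eq_measure[symmetric])
    also have "\<dots> \<le> ennreal (\<nu> (topspace S - C))"
      using U by (simp add: outer_open inner_le_charge)
    finally have "measure \<mu> (topspace S - C) \<le> \<nu> (topspace S - C)"
      using nonneg[of "topspace S - C"] by (simp add: ennreal_le_iff)
    moreover have "measure \<mu> (topspace S - C) = 1 - measure \<mu> C"
    proof -
      have "C = space \<mu> - (topspace S - C)" using sub space by auto
      then have "C \<in> sets \<mu>" using UB by (metis sets.compl_sets)
      then show ?thesis using \<mu>.prob_compl[of C] space by simp
    qed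
    moreover have "\<nu> (topspace S - C) = 1 - \<nu> C"
      using additive[of C "topspace S - C"] sub total by (simp add: Un_absorb1)
    ultimately show "\<nu> C \<le> measure \<mu> C" by simp
  qed
qed

end

section \<open>Means on bounded functions and their representing measures\<close>

text \<open>
  Finitely additive integration on the bounded functions on \<open>\<Omega>\<close>. Functions are total, and only their values
  on \<open>\<Omega>\<close> matter, by monotonicity.
\<close>

definition mean_on :: "'c set \<Rightarrow> (('c \<Rightarrow> real) \<Rightarrow> real) \<Rightarrow> bool" where
  "mean_on \<Omega> \<Lambda> \<longleftrightarrow>
     (\<forall>f g. bounded (f ` \<Omega>) \<longrightarrow> bounded (g ` \<Omega>) \<longrightarrow> \<Lambda> (\<lambda>x. f x + g x) = \<Lambda> f + \<Lambda> g) \<and>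
     (\<forall>c f. bounded (f ` \<Omega>) \<longrightarrow> \<Lambda> (\<lambda>x. c * f x) = c * \<Lambda> f) \<and>
     (\<forall>f g. bounded (f ` \<Omega>) \<longrightarrow> bounded (g ` \<Omega>) \<longrightarrow> (\<forall>x\<in>\<Omega>. f x \<le> g x) \<longrightarrow> \<Lambda> f \<le> \<Lambda> g) \<and>
     \<Lambda> (\<lambda>_. 1) = 1"

lemma mean_on_add: "mean_on \<Omega> \<Lambda> \<Longrightarrow> bounded (f ` \<Omega>) \<Longrightarrow> bounded (g ` \<Omega>) \<Longrightarrow> \<Lambda> (\<lambda>x. f x + g x) = \<Lambda> f + \<Lambda> g"
  and mean_on_scale: "mean_on \<Omega> \<Lambda> \<Longrightarrow> bounded (f ` \<Omega>) \<Longrightarrow> \<Lambda> (\<lambda>x. c * f x) = c * \<Lambda> f"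
  and mean_on_mono: "mean_on \<Omega> \<Lambda> \<Longrightarrow> bounded (f ` \<Omega>) \<Longrightarrow> bounded (g ` \<Omega>) \<Longrightarrow> (\<And>x. x \<in> \<Omega> \<Longrightarrow> f x \<le> g x) \<Longrightarrow> \<Lambda> f \<le> \<Lambda> g"
  and mean_on_one: "mean_on \<Omega> \<Lambda> \<Longrightarrow> \<Lambda> (\<lambda>_. 1) = 1"
  by (auto simp: mean_on_def)

lemma mean_on_const: "mean_on \<Omega> \<Lambda> \<Longrightarrow> \<Lambda> (\<lambda>_. c) = c"
  using mean_on_scale[of \<Omega> \<Lambda> "\<lambda>_. 1" c] mean_on_one[of \<Omega> \<Lambda>] by (auto simp: image_constant_conv)

lemma bounded_sum_image:
  fixes f :: "'i \<Rightarrow> 'c \<Rightarrow> real"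
  assumes "\<And>i. i \<in> I \<Longrightarrow> bounded (f i ` \<Omega>)"
  shows "bounded ((\<lambda>x. \<Sum>i\<in>I. f i x) ` \<Omega>)"
  using assms
proof (induction I rule: infinite_finite_induct)
  case (insert a I)
  then have "bounded ((\<lambda>x. f a x + (\<Sum>i\<in>I. f i x)) ` \<Omega>)" by (intro bounded_plus_comp) auto
  then show ?case using insert by simp
qed (auto simp: image_constant_conv)

lemma mean_on_sum:
  assumes "mean_on \<Omega> \<Lambda>" "\<And>i. i \<in> I \<Longrightarrow> bounded (f i ` \<Omega>)"
  shows "\<Lambda> (\<lambda>x. \<Sum>i\<in>I. f i x) = (\<Sum>i\<in>I. \<Lambda> (f i))"
  using assms(2)
proof (induction I rule: infinite_finite_induct)
  case (insert a I)
  then have "\<Lambda> (\<lambda>x. f a x + (\<Sum>i\<in>I. f i x)) = \<Lambda> (f a) + \<Lambda> (\<lambda>x. \<Sum>i\<in>I. f i x)"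
    by (intro mean_on_add[OF assms(1)] bounded_sum_image) auto
  then show ?case using insert by simp
qed (use mean_on_const[OF assms(1)] in auto)

lemma bounded_indicator_image: "bounded ((indicator A :: 'c \<Rightarrow> real) ` \<Omega>)"
  by (rule bounded_subset[of "{0, 1}"]) (auto simp: indicator_def)

lemma bounded_const_image: "bounded ((\<lambda>_. c :: real) ` \<Omega>)"
  by (rule bounded_subset[of "{c}"]) auto

lemma compact_charge_mean:
  assumes "compact_space S" "Hausdorff_space S" and \<Lambda>: "mean_on (topspace S) \<Lambda>"
  shows "compact_charge S (\<lambda>A. \<Lambda> (indicator A))"
proof
  fix A B
  show "0 \<le> \<Lambda> (indicator A)"
    using mean_on_mono[OF \<Lambda>, of "\<lambda>_. 0" "indicator A"] mean_on_const[OF \<Lambda>, of 0]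
      bounded_indicator_image bounded_const_image
    by auto
  assume "A \<inter> B = {}"
  then have "(indicator (A \<union> B) :: _ \<Rightarrow> real) = (\<lambda>x. indicator A x + indicator B x)"
    by (auto simp: indicator_def fun_eq_iff)
  then show "\<Lambda> (indicator (A \<union> B)) = \<Lambda> (indicator A) + \<Lambda> (indicator B)"
    using mean_on_add[OF \<Lambda> bounded_indicator_image bounded_indicator_image] by simp
qed (use assms in auto)

text \<open>
  The sum counts the positive integers up to \<open>t * N\<close>, so it equals the floor of \<open>t * N\<close>.
\<close>

lemma sum_indicator_levels:
  fixes N K :: nat and t :: real
  assumes N: "0 < N" and t: "0 \<le> t" "t * N \<le> K"
  shows "(\<Sum>k=1..K. (if k \<le> t * N then 1 else 0)) / N \<le> t"
    and "t \<le> (\<Sum>k=1..K. (if k \<le> t * N then 1 else 0)) / N + 1 / N"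
proof -
  have le: "real k \<le> t * N \<longleftrightarrow> k \<le> nat \<lfloor>t * N\<rfloor>" for k :: nat
    using t by (simp add: le_nat_floor le_nat_iff le_floor_iff)
  have "nat \<lfloor>t * N\<rfloor> \<le> K" using t by linarith
  then have "{k \<in> {1..K}. real k \<le> t * N} = {1..nat \<lfloor>t * N\<rfloor>}" unfolding le by auto
  then have "(\<Sum>k=1..K. (if k \<le> t * N then 1 else 0)) = real (nat \<lfloor>t * N\<rfloor>)"
    by (simp add: sum.If_cases Int_def)
  moreover have "real (nat \<lfloor>t * N\<rfloor>) \<le> t * N" "t * N \<le> real (nat \<lfloor>t * N\<rfloor>) + 1"
  proof -
    have "0 \<le> t * real N" using t by simp
    then have "real (nat \<lfloor>t * N\<rfloor>) = of_int \<lfloor>t * N\<rfloor>" by simp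
    then show "real (nat \<lfloor>t * N\<rfloor>) \<le> t * N" "t * N \<le> real (nat \<lfloor>t * N\<rfloor>) + 1" by linarith+
  qed
  ultimately show "(\<Sum>k=1..K. (if k \<le> t * N then 1 else 0)) / N \<le> t"
    "t \<le> (\<Sum>k=1..K. (if k \<le> t * N then 1 else 0)) / N + 1 / N"
    using N by (auto simp: field_simps)
qed

lemma space_borel_algebra: "space (borel_algebra S) = topspace S"
  by (simp add: borel_algebra_def space_measure_of_conv)

lemma continuous_map_borel_measurable:
  assumes f: "continuous_map S euclidean f" and M: "sets M = sets (borel_algebra S)"
  shows "f \<in> borel_measurable M"
proof -
  have opens: "{U. openin S U} \<subseteq> Pow (topspace S)" by (auto dest: openin_subset)
  have "f \<in> borel_measurable (borel_algebra S)"
  proof (rule borel_measurableI)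
    fix U :: "'b set" assume "open U"
    then have "openin S {x \<in> topspace S. f x \<in> U}"
      using openin_continuous_map_preimage[OF f] by simp
    moreover have "{x \<in> topspace S. f x \<in> U} = f -` U \<inter> space (borel_algebra S)"
      by (auto simp: space_borel_algebra)
    ultimately show "f -` U \<inter> space (borel_algebra S) \<in> sets (borel_algebra S)"
      using opens by (auto simp: borel_algebra_def)
  qed
  then show ?thesis using measurable_cong_sets[OF M refl] by blast
qed

lemma continuous_map_compact_bounded:
  fixes f :: "'c \<Rightarrow> real"
  assumes "compact_space S" "continuous_map S euclidean f"
  shows "bounded (f ` topspace S)"
  using image_compactin[of S "topspace S" euclidean f] assms
  by (auto simp: compact_space_def compact_imp_bounded)

lemma integrable_continuous_map_compact:
  fixes f :: "'c \<Rightarrow> real"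
  assumes "prob_space \<mu>" and \<mu>: "sets \<mu> = sets (borel_algebra S)"
    and S: "compact_space S" and f: "continuous_map S euclidean f"
  shows "integrable \<mu> f"
proof -
  interpret prob_space \<mu> by fact
  obtain B where "\<And>x. x \<in> topspace S \<Longrightarrow> norm (f x) \<le> B"
    using continuous_map_compact_bounded[OF S f] by (auto simp: bounded_iff)
  moreover have "space \<mu> = topspace S"
    using sets_eq_imp_space_eq[OF \<mu>] by (simp add: space_borel_algebra)
  ultimately show ?thesis
    using continuous_map_borel_measurable[OF f \<mu>]
    by (intro integrable_const_bound[of _ B]) (auto intro!: AE_I2)
qed

text \<open>
  A nonnegative continuous function lies within \<open>1 / N\<close> above a combination, with nonnegative coefficients,
  of indicators of its closed superlevel sets. So the inequality between charge and measure on
  closed sets carries over to integrals. Applying it to \<open>f\<close> and \<open>- f\<close>, both shifted by constants, turns it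
  into an equality.
\<close>

lemma ex_borel_measure_representing_mean:
  assumes S: "compact_space S" "Hausdorff_space S" and \<Lambda>: "mean_on (topspace S) \<Lambda>"
  obtains \<mu> where "prob_space \<mu>" "sets \<mu> = sets (borel_algebra S)"
    "\<And>f. continuous_map S euclideanreal f \<Longrightarrow> \<Lambda> f = (\<integral>x. f x \<partial>\<mu>)"
proof -
  let ?\<Omega> = "topspace S"
  interpret compact_charge S "\<lambda>A. \<Lambda> (indicator A)"
    by (rule compact_charge_mean[OF S \<Lambda>])
  have "\<Lambda> (indicator ?\<Omega>) = 1"
    using mean_on_mono[OF \<Lambda> bounded_indicator_image bounded_const_image, of ?\<Omega> 1]
      mean_on_mono[OF \<Lambda> bounded_const_image bounded_indicator_image, of 1 ?\<Omega>] mean_on_one[OF \<Lambda>]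
    by auto
  then obtain \<mu> where \<mu>: "prob_space \<mu>" "sets \<mu> = sets (borel_algebra S)"
    and dom: "\<And>C. closedin S C \<Longrightarrow> \<Lambda> (indicator C) \<le> measure \<mu> C"
    using ex_borel_measure_ge_charge_on_closed by blast
  interpret \<mu>: prob_space \<mu> by (rule \<mu>(1))
  have opens: "{U. openin S U} \<subseteq> Pow ?\<Omega>" by (auto dest: openin_subset)
  have space: "space \<mu> = ?\<Omega>"
    using sets_eq_imp_space_eq[OF \<mu>(2)] by (simp add: space_borel_algebra)
  have int: "integrable \<mu> f" if "continuous_map S euclideanreal f" for f
    by (rule integrable_continuous_map_compact[OF \<mu> S(1) that])
  have le: "\<Lambda> f \<le> (\<integral>x. f x \<partial>\<mu>)"
    if f: "continuous_map S euclideanreal f" and pos: "\<And>x. x \<in> ?\<Omega> \<Longrightarrow> 0 \<le> f x" for f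
  proof -
    have bf: "bounded (f ` ?\<Omega>)" by (rule continuous_map_compact_bounded[OF S(1) f])
    then obtain B where "\<And>x. x \<in> ?\<Omega> \<Longrightarrow> \<bar>f x\<bar> \<le> B" by (auto simp: bounded_iff)
    then have B: "\<And>x. x \<in> ?\<Omega> \<Longrightarrow> f x \<le> B" by (simp add: abs_le_iff)
    have approx: "\<Lambda> f \<le> (\<integral>x. f x \<partial>\<mu>) + 1 / real (Suc M)" for M
    proof -
      let ?N = "Suc M"
      \<comment> \<open>The levels \<open>k / N\<close> with \<open>k \<le> K\<close> reach the upper bound \<open>B\<close> of \<open>f\<close>.\<close>
      obtain K :: nat where K: "B * ?N \<le> K" using real_arch_simple by blast
      define C where "C k = {x \<in> ?\<Omega>. real k \<le> f x * ?N}" for k :: nat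
      let ?s = "\<lambda>x. \<Sum>k=1..K. indicator (C k) x * (1 / ?N)"
      have C: "closedin S (C k)" for k
      proof -
        have "C k = {x \<in> ?\<Omega>. f x \<in> {real k / ?N..}}"
          by (auto simp: C_def field_simps)
        then show ?thesis using closedin_continuous_map_preimage[OF f, of "{real k / ?N..}"] by simp
      qed
      have Cs: "C k \<in> sets \<mu>" for k
      proof -
        have "openin S (?\<Omega> - C k)" using C by auto
        then have "?\<Omega> - C k \<in> sets \<mu>" unfolding \<mu>(2) using opens by (auto simp: borel_algebra_def)
        moreover have "C k = space \<mu> - (?\<Omega> - C k)" using space by (auto simp: C_def)
        ultimately show ?thesis by (metis sets.compl_sets)
      qed
      have iC: "integrable \<mu> (\<lambda>x. indicator (C k) x * (1 / real ?N))" for k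
        by (intro integrable_mult_left integrable_real_indicator Cs) (simp add: \<mu>.emeasure_eq_measure)
      have "C k \<inter> space \<mu> = C k" for k using space by (auto simp: C_def)
      then have int_C: "(\<integral>x. indicator (C k) x * (1 / real ?N) \<partial>\<mu>) = measure \<mu> (C k) * (1 / real ?N)" for k
        by simp
      have s_eq: "?s x = (\<Sum>k=1..K. (if k \<le> f x * ?N then 1 else 0)) / ?N" if "x \<in> ?\<Omega>" for x
        unfolding sum_divide_distrib using that by (intro sum.cong) (auto simp: C_def indicator_def)
      have s: "?s x \<le> f x" "f x \<le> ?s x + 1 / ?N" if "x \<in> ?\<Omega>" for x
      proof -
        have "f x * ?N \<le> K" using B[OF that] K
          by (meson mult_right_mono of_nat_0_le_iff order_trans)
        then show "?s x \<le> f x" "f x \<le> ?s x + 1 / ?N"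
          unfolding s_eq[OF that]
          using sum_indicator_levels[of ?N "f x" K] pos[OF that] by auto
      qed
      have bi: "bounded ((\<lambda>x. indicator (C k) x * (1 / ?N)) ` ?\<Omega>)" for k
        by (rule bounded_subset[of "{0, 1 / ?N}"]) (auto simp: indicator_def)
      have bs: "bounded (?s ` ?\<Omega>)" by (intro bounded_sum_image bi)
      have bc: "bounded ((\<lambda>_. 1 / real ?N) ` ?\<Omega>)" by (rule bounded_const_image)
      have "\<Lambda> f \<le> \<Lambda> (\<lambda>x. ?s x + 1 / ?N)"
        using s(2) by (intro mean_on_mono[OF \<Lambda>] bf bounded_plus_comp bs bc)
      also have "\<dots> = \<Lambda> ?s + 1 / ?N"
        using mean_on_add[OF \<Lambda> bs bc] mean_on_const[OF \<Lambda>] by simp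
      also have "\<Lambda> ?s = (\<Sum>k=1..K. \<Lambda> (\<lambda>x. indicator (C k) x * (1 / ?N)))"
        by (intro mean_on_sum[OF \<Lambda>] bi)
      also have "\<dots> = (\<Sum>k=1..K. \<Lambda> (indicator (C k)) * (1 / ?N))"
        using mean_on_scale[OF \<Lambda> bounded_indicator_image, of "1 / ?N"] by (simp add: mult.commute)
      also have "\<dots> \<le> (\<Sum>k=1..K. measure \<mu> (C k) * (1 / ?N))"
        by (intro sum_mono mult_right_mono dom C) auto
      also have "\<dots> = (\<integral>x. ?s x \<partial>\<mu>)"
        by (simp only: Bochner_Integration.integral_sum[OF iC] int_C)
      also have "\<dots> \<le> (\<integral>x. f x \<partial>\<mu>)"
        using s(1) space by (intro integral_mono int f Bochner_Integration.integrable_sum iC) auto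
      finally show ?thesis by simp
    qed
    show ?thesis
    proof (rule field_le_epsilon)
      fix e :: real assume "0 < e"
      then obtain M where "inverse (real (Suc M)) < e" using reals_Archimedean by blast
      then show "\<Lambda> f \<le> (\<integral>x. f x \<partial>\<mu>) + e" using approx[of M] by (simp add: inverse_eq_divide)
    qed
  qed
  have le': "\<Lambda> f \<le> (\<integral>x. f x \<partial>\<mu>)" if f: "continuous_map S euclideanreal f" for f
  proof -
    have bf: "bounded (f ` ?\<Omega>)" by (rule continuous_map_compact_bounded[OF S(1) f])
    then obtain B where B: "\<And>x. x \<in> ?\<Omega> \<Longrightarrow> \<bar>f x\<bar> \<le> B" by (auto simp: bounded_iff)
    \<comment> \<open>Adding the constant \<open>B\<close> makes \<open>f\<close> nonnegative.\<close>
    have "\<Lambda> (\<lambda>x. f x + B) \<le> (\<integral>x. f x + B \<partial>\<mu>)"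
      using B by (intro le continuous_map_add f) (auto simp: abs_le_iff, force)
    moreover have "\<Lambda> (\<lambda>x. f x + B) = \<Lambda> f + B"
      using mean_on_add[OF \<Lambda> bf bounded_const_image, of B] mean_on_const[OF \<Lambda>, of B] by simp
    moreover have "(\<integral>x. f x + B \<partial>\<mu>) = (\<integral>x. f x \<partial>\<mu>) + B"
      using int[OF f] by (simp add: \<mu>.prob_space)
    ultimately show ?thesis by simp
  qed
  show thesis
  proof (rule that[OF \<mu>])
    fix f assume f: "continuous_map S euclideanreal f"
    have "\<Lambda> (\<lambda>x. - f x) = - \<Lambda> f"
      using mean_on_scale[OF \<Lambda> continuous_map_compact_bounded[OF S(1) f], of "-1"] by simp
    then show "\<Lambda> f = (\<integral>x. f x \<partial>\<mu>)"
      using le'[OF f] le'[OF continuous_map_minus[OF f]] by simp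
  qed
qed

text \<open>
  The sublinear functional is the supremum over \<open>\<Omega>\<close>. To have a vector space of bounded functions as a type, the
  functions on \<open>\<Omega>\<close> are extended by zero and regarded as bounded continuous functions on the discrete space.
\<close>

lemma ex_mean_nonneg_on:
  fixes H :: "('c \<Rightarrow> real) set"
  assumes bdd: "\<And>h. h \<in> H \<Longrightarrow> bounded (h ` \<Omega>)"
    and scale: "\<And>c h. 0 < c \<Longrightarrow> h \<in> H \<Longrightarrow> (\<lambda>x. c * h x) \<in> H"
    and nonneg: "\<And>hs. hs \<in> lists H \<Longrightarrow> \<exists>x\<in>\<Omega>. 0 \<le> (\<Sum>h\<leftarrow>hs. h x)"
  obtains \<Lambda> where "mean_on \<Omega> \<Lambda>" "\<And>h. h \<in> H \<Longrightarrow> 0 \<le> \<Lambda> h"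
proof -
  define J :: "('c \<Rightarrow> real) \<Rightarrow> ('c discrete \<Rightarrow>\<^sub>C real)" where
    "J f = Bcontfun (\<lambda>y. if of_discrete y \<in> \<Omega> then f (of_discrete y) else 0)" for f
  define p :: "('c discrete \<Rightarrow>\<^sub>C real) \<Rightarrow> real" where "p F = (SUP x\<in>\<Omega>. F (discrete x))" for F
  have \<Omega>: "\<Omega> \<noteq> {}" using nonneg[of "[]"] by auto
  have J: "J f (discrete x) = (if x \<in> \<Omega> then f x else 0)" if f: "bounded (f ` \<Omega>)" for f :: "'c \<Rightarrow> real" and x
  proof -
    obtain B where B: "\<And>x. x \<in> \<Omega> \<Longrightarrow> norm (f x) \<le> B" "0 \<le> B"
      using f by (fastforce simp: bounded_pos)
    have "(\<lambda>y. if of_discrete y \<in> \<Omega> then f (of_discrete y) else 0) \<in> bcontfun"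
      using B by (intro bcontfun_normI[of _ B]) (auto simp: continuous_on_open_vimage open_discrete)
    then show "J f (discrete x) = (if x \<in> \<Omega> then f x else 0)"
      by (simp add: J_def Bcontfun_inverse discrete_inverse)
  qed
  have eqI: "F = G" if "\<And>x. F (discrete x) = G (discrete x)" for F G :: "'c discrete \<Rightarrow>\<^sub>C real"
    by (rule bcontfun_eqI) (metis that of_discrete_inverse)
  have J_add: "J (\<lambda>x. f x + g x) = J f + J g" if "bounded (f ` \<Omega>)" "bounded (g ` \<Omega>)" for f g :: "'c \<Rightarrow> real"
    by (rule eqI) (simp add: J that bounded_plus_comp)
  have J_scale: "J (\<lambda>x. c * f x) = c *\<^sub>R J f" if "bounded (f ` \<Omega>)" for c and f :: "'c \<Rightarrow> real"
  proof -
    have "bounded ((\<lambda>x. c *\<^sub>R f x) ` \<Omega>)" using that by (rule bounded_scaleR_comp)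
    then show ?thesis by (intro eqI) (simp add: J that)
  qed
  have up: "F (discrete x) \<le> p F" if "x \<in> \<Omega>" for F :: "'c discrete \<Rightarrow>\<^sub>C real" and x
    unfolding p_def using that
    by (intro cSUP_upper bdd_above.I2[of _ _ "norm F"]) (use norm_bounded[of F] in \<open>auto simp: abs_le_iff\<close>)
  have least: "p F \<le> b" if "\<And>x. x \<in> \<Omega> \<Longrightarrow> F (discrete x) \<le> b" for F :: "'c discrete \<Rightarrow>\<^sub>C real" and b
    unfolding p_def using \<Omega> that by (rule cSUP_least)
  have sub: "sublinear p"
  proof (rule sublinearI)
    show "p (F + G) \<le> p F + p G" for F G by (intro least) (auto intro: add_mono up)
    show "p (c *\<^sub>R F) \<le> c * p F" if "0 < c" for c F using that by (intro least) (auto intro: up)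
  qed
  have "\<exists>L. linear L \<and> L \<le> p \<and> (\<forall>F\<in>J ` H. 0 \<le> L F)"
  proof (rule ex_linear_le_sublinear_nonneg_on[OF sub])
    show "c *\<^sub>R F \<in> J ` H" if "0 < c" "F \<in> J ` H" for c F
      using that scale J_scale bdd by (auto simp flip: J_scale)
    fix Fs assume "Fs \<in> lists (J ` H)"
    then obtain hs where hs: "hs \<in> lists H" "Fs = map J hs" by (auto simp: lists_image)
    then obtain x where x: "x \<in> \<Omega>" "0 \<le> (\<Sum>h\<leftarrow>hs. h x)" using nonneg by blast
    have "sum_list (map J hs) (discrete x) = (\<Sum>h\<leftarrow>hs. h x)"
      using hs(1) by (induction hs) (auto simp: J x bdd)
    then show "0 \<le> p (sum_list Fs)" using up[OF x(1), of "sum_list Fs"] x(2) hs(2) by simp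
  qed
  then obtain L where L: "linear L" "\<And>F. L F \<le> p F" "\<And>h. h \<in> H \<Longrightarrow> 0 \<le> L (J h)"
    by (auto simp: le_fun_def)
  have b1: "bounded ((\<lambda>_. 1 :: real) ` \<Omega>)" by (rule bounded_const_image)
  show thesis
  proof (rule that[of "\<lambda>f. L (J f)"])
    show "mean_on \<Omega> (\<lambda>f. L (J f))"
      unfolding mean_on_def
    proof (intro conjI allI impI)
      fix f g :: "'c \<Rightarrow> real" assume f: "bounded (f ` \<Omega>)" and g: "bounded (g ` \<Omega>)"
      show "L (J (\<lambda>x. f x + g x)) = L (J f) + L (J g)"
        using J_add[OF f g] linear_add[OF L(1)] by simp
      assume "\<forall>x\<in>\<Omega>. f x \<le> g x"
      then have "p (J f - J g) \<le> 0" by (intro least) (auto simp: J f g)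
      then show "L (J f) \<le> L (J g)" using L(2)[of "J f - J g"] linear_diff[OF L(1)] by simp
    next
      fix c and f :: "'c \<Rightarrow> real" assume "bounded (f ` \<Omega>)"
      then show "L (J (\<lambda>x. c * f x)) = c * L (J f)" using J_scale linear_scale[OF L(1)] by simp
    next
      have "p (J (\<lambda>_. 1)) \<le> 1" "p (- J (\<lambda>_. 1)) \<le> - 1" by (intro least; simp add: J[OF b1])+
      then show "L (J (\<lambda>_. 1)) = 1"
        using L(2)[of "J (\<lambda>_. 1)"] L(2)[of "- J (\<lambda>_. 1)"] linear_neg[OF L(1)] by simp
    qed
  qed (rule L(3))
qed

text \<open>
  Since a positive multiple of an element of \<open>H\<close> is in \<open>H\<close>, the sums of lists from \<open>H\<close> form a
  convex cone. The hypothesis says that no function in this cone is negative everywhere.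
\<close>

lemma ex_borel_measure_nonneg_on_cone:
  fixes H :: "('c \<Rightarrow> real) set"
  assumes S: "compact_space S" "Hausdorff_space S"
    and cont: "\<And>h. h \<in> H \<Longrightarrow> continuous_map S euclideanreal h"
    and scale: "\<And>c h. 0 < c \<Longrightarrow> h \<in> H \<Longrightarrow> (\<lambda>x. c * h x) \<in> H"
    and nonneg: "\<And>hs. hs \<in> lists H \<Longrightarrow> \<exists>x\<in>topspace S. 0 \<le> (\<Sum>h\<leftarrow>hs. h x)"
  shows "\<exists>\<mu>. prob_space \<mu> \<and> sets \<mu> = sets (borel_algebra S) \<and> (\<forall>h\<in>H. 0 \<le> (\<integral>x. h x \<partial>\<mu>))"
proof -
  obtain \<Lambda> where \<Lambda>: "mean_on (topspace S) \<Lambda>" "\<And>h. h \<in> H \<Longrightarrow> 0 \<le> \<Lambda> h"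
    using ex_mean_nonneg_on[of H "topspace S"] continuous_map_compact_bounded[OF S(1) cont] scale nonneg
    by metis
  obtain \<mu> where "prob_space \<mu>" "sets \<mu> = sets (borel_algebra S)"
    "\<And>f. continuous_map S euclideanreal f \<Longrightarrow> \<Lambda> f = (\<integral>x. f x \<partial>\<mu>)"
    using ex_borel_measure_representing_mean[OF S \<Lambda>(1)] by metis
  then show ?thesis using \<Lambda>(2) cont by metis
qed

section \<open>Duals of normed spaces and the weak-star compact ball\<close>

lemma scalar_field_simps [simp]:
  "carrier (scalar_field K) = K" "x \<oplus>\<^bsub>scalar_field K\<^esub> y = x + y" "x \<otimes>\<^bsub>scalar_field K\<^esub> y = x * y"
  "\<zero>\<^bsub>scalar_field K\<^esub> = 0" "\<one>\<^bsub>scalar_field K\<^esub> = 1" "c \<odot>\<^bsub>scalar_field K\<^esub> x = c * x"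
  "nrm (scalar_field K) x = cmod x"
  by (simp_all add: scalar_field_def)

lemma subset_Ball_cong:
  "(\<And>x. x \<in> M \<Longrightarrow> P x \<longleftrightarrow> Q x) \<Longrightarrow> (U \<subseteq> M \<and> (\<forall>x. x \<in> U \<longrightarrow> P x)) \<longleftrightarrow> (U \<subseteq> M \<and> (\<forall>x\<in>U. Q x))"
  by blast

text \<open>
  Normed spaces over the real or the complex numbers: only here is it known that \<open>K\<close> contains the real
  scalars, hence that vectors can be normalized.
\<close>

locale normed_space_RC = normed_space K V
  for K :: "complex set" and V :: "'a normed_module" (structure) +
  assumes scalars: "K = \<real> \<or> K = UNIV"
begin

lemma K_closed [simp]:
  "complex_of_real r \<in> K" "0 \<in> K" "1 \<in> K" "x \<in> K \<Longrightarrow> - x \<in> K"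
  "x \<in> K \<Longrightarrow> y \<in> K \<Longrightarrow> x + y \<in> K" "x \<in> K \<Longrightarrow> y \<in> K \<Longrightarrow> x - y \<in> K" "x \<in> K \<Longrightarrow> y \<in> K \<Longrightarrow> x * y \<in> K"
  using scalars by auto

lemma closed_K: "closed K"
  using scalars closed_complex_Reals by auto

lemma scalar_uminus: "x \<in> K \<Longrightarrow> \<ominus>\<^bsub>scalar_field K\<^esub> x = - x"
  by (rule R.minus_equality) auto

lemma smult_closed' [simp]: "c \<in> K \<Longrightarrow> x \<in> carrier V \<Longrightarrow> c \<odot> x \<in> carrier V"
  using smult_closed by simp

lemma smult_zero_left: "x \<in> carrier V \<Longrightarrow> 0 \<odot> x = \<zero>"
  using smult_l_null[of x] by simp

lemma smult_minus_one: "x \<in> carrier V \<Longrightarrow> (-1) \<odot> x = \<ominus> x"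
  using smult_l_minus[of 1 x] smult_one[of x] scalar_uminus[of 1] by simp

lemma nrm_zero [simp]: "nrm V \<zero> = 0"
  by (simp add: nrm_eq_zero_iff)

lemma nrm_minus: "x \<in> carrier V \<Longrightarrow> nrm V (\<ominus> x) = nrm V x"
  using nrm_smult[of "-1" x] by (simp add: smult_minus_one)

lemma nrm_nonneg [simp]: "x \<in> carrier V \<Longrightarrow> 0 \<le> nrm V x"
  using nrm_triangle[of x "\<ominus> x"] by (simp add: nrm_minus M.r_neg)

lemma norm_dist_eq: "x \<in> carrier V \<Longrightarrow> y \<in> carrier V \<Longrightarrow> norm_dist V x y = nrm V (x \<ominus> y)"
  by (simp add: norm_dist_def)

lemma Metric_space_norm_dist: "Metric_space (carrier V) (norm_dist V)"
proof
  fix x y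
  show "0 \<le> norm_dist V x y" by (simp add: norm_dist_def)
  have "nrm V (x \<ominus> y) = nrm V (y \<ominus> x)" if "x \<in> carrier V" "y \<in> carrier V"
    using that nrm_minus[of "x \<ominus> y"] by (simp add: a_minus_def M.minus_add M.a_comm)
  then show "norm_dist V x y = norm_dist V y x" by (auto simp: norm_dist_def)
next
  fix x y assume xy: "x \<in> carrier V" "y \<in> carrier V"
  then have "(x \<ominus> y) \<oplus> y = x" by (simp add: a_minus_def M.a_assoc M.l_neg)
  with xy have "x \<ominus> y = \<zero> \<longleftrightarrow> x = y" by (auto simp: a_minus_def M.r_neg)
  with xy show "norm_dist V x y = 0 \<longleftrightarrow> x = y" by (simp add: norm_dist_eq nrm_eq_zero_iff)
  fix z assume z: "z \<in> carrier V"
  have "x \<ominus> z = (x \<ominus> y) \<oplus> (y \<ominus> z)"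
    using xy z by (simp add: a_minus_def M.a_assoc M.r_neg1)
  then show "norm_dist V x z \<le> norm_dist V x y + norm_dist V y z"
    using xy z nrm_triangle[of "x \<ominus> y" "y \<ominus> z"] by (simp add: norm_dist_eq)
qed

lemma openin_norm_topology:
  "openin (norm_topology V) U \<longleftrightarrow>
     U \<subseteq> carrier V \<and> (\<forall>x\<in>U. \<exists>r>0. \<forall>y\<in>carrier V. nrm V (y \<ominus> x) < r \<longrightarrow> y \<in> U)"
proof -
  interpret Metric_space "carrier V" "norm_dist V" by (rule Metric_space_norm_dist)
  have "mball x r \<subseteq> U \<longleftrightarrow> (\<forall>y\<in>carrier V. nrm V (y \<ominus> x) < r \<longrightarrow> y \<in> U)" if "x \<in> carrier V" for x r
    using that commute[of x] by (auto simp: subset_iff norm_dist_eq)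
  then show ?thesis
    unfolding norm_topology_def openin_mtopology by (intro subset_Ball_cong) simp
qed

lemma topspace_norm_topology [simp]: "topspace (norm_topology V) = carrier V"
  unfolding norm_topology_def
  by (rule Metric_space.topspace_mtopology[OF Metric_space_norm_dist])

lemma norm_topology_scalar_field: "norm_topology (scalar_field K) = top_of_set K"
proof -
  have diff: "x \<ominus>\<^bsub>scalar_field K\<^esub> y = x - y" if "x \<in> K" "y \<in> K" for x y
    using that by (simp add: a_minus_def scalar_uminus)
  interpret S: Metric_space K "norm_dist (scalar_field K)"
  proof
    fix x y z assume "x \<in> K" "y \<in> K" "z \<in> K"
    then show "norm_dist (scalar_field K) x z
        \<le> norm_dist (scalar_field K) x y + norm_dist (scalar_field K) y z"
      using norm_triangle_ineq[of "x - y" "y - z"] by (simp add: norm_dist_def diff)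
  qed (auto simp: norm_dist_def diff norm_minus_commute)
  have "openin S.mtopology U \<longleftrightarrow> openin (top_of_set K) U" for U
  proof -
    have "S.mball x r \<subseteq> U \<longleftrightarrow> (\<forall>y\<in>K. dist y x < r \<longrightarrow> y \<in> U)" if "x \<in> K" for x r
      using that by (auto simp: subset_iff norm_dist_def diff dist_norm norm_minus_commute)
    then show ?thesis
      unfolding S.openin_mtopology openin_euclidean_subtopology_iff by (intro subset_Ball_cong) simp
  qed
  then show ?thesis by (simp add: norm_topology_def topology_eq)
qed

definition linear_functional :: "('a \<Rightarrow> complex) \<Rightarrow> bool" where
  "linear_functional f \<longleftrightarrow>
     (\<forall>x\<in>carrier V. f x \<in> K) \<and>
     (\<forall>x\<in>carrier V. \<forall>y\<in>carrier V. f (x \<oplus> y) = f x + f y) \<and>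
     (\<forall>c\<in>K. \<forall>x\<in>carrier V. f (c \<odot> x) = c * f x)"

lemma linear_map_scalar_iff: "linear_map K V (scalar_field K) f \<longleftrightarrow> linear_functional f"
  by (auto simp: linear_map_def linear_functional_def)

lemma linear_functional_zero: "linear_functional f \<Longrightarrow> f \<zero> = 0"
  using smult_zero_left[of \<zero>] unfolding linear_functional_def by (metis K_closed(2) M.zero_closed mult_zero_left)

lemma linear_functional_diff:
  assumes "linear_functional f" "x \<in> carrier V" "y \<in> carrier V" shows "f (x \<ominus> y) = f x - f y"
proof -
  have "f (x \<ominus> y) = f (x \<oplus> (-1) \<odot> y)" using assms by (simp add: a_minus_def smult_minus_one)
  also have "\<dots> = f x - f y" using assms by (simp add: linear_functional_def)
  finally show ?thesis .
qed

text \<open>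
  Continuity at zero bounds the functional by one on a ball, and homogeneity spreads this bound.
\<close>

lemma continuous_imp_bounded_functional:
  assumes f: "linear_functional f" and cont: "continuous_map (norm_topology V) (top_of_set K) f"
  shows "\<exists>C. \<forall>x\<in>carrier V. cmod (f x) \<le> C * nrm V x"
proof -
  have "openin (norm_topology V) {x \<in> topspace (norm_topology V). f x \<in> ball 0 1}"
    using cont by (intro openin_continuous_map_preimage[of _ euclidean]) (auto simp: continuous_map_in_subtopology)
  moreover have "\<zero> \<in> {x \<in> topspace (norm_topology V). f x \<in> ball 0 1}"
    using linear_functional_zero[OF f] by simp
  ultimately have "\<exists>r>0. \<forall>y\<in>carrier V. nrm V (y \<ominus> \<zero>) < r \<longrightarrow>
      y \<in> {x \<in> topspace (norm_topology V). f x \<in> ball 0 1}"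
    unfolding openin_norm_topology by (elim conjE) (rule bspec)
  then obtain r where r: "r > 0" "\<And>y. y \<in> carrier V \<Longrightarrow> nrm V (y \<ominus> \<zero>) < r \<Longrightarrow> cmod (f y) < 1"
    by auto
  have "cmod (f x) \<le> 2 / r * nrm V x" if x: "x \<in> carrier V" for x
  proof (cases "nrm V x = 0")
    case True
    then show ?thesis using linear_functional_zero[OF f] x by (simp add: nrm_eq_zero_iff)
  next
    case False
    then have pos: "nrm V x > 0" using nrm_nonneg[OF x] by simp
    define c where "c = complex_of_real (r / (2 * nrm V x))"
    have c: "c \<in> K" unfolding c_def by (rule K_closed(1))
    have cmod_c: "cmod c = r / (2 * nrm V x)" unfolding c_def norm_of_real using pos r(1) by simp
    have "nrm V (c \<odot> x) = cmod c * nrm V x" using x c by (rule nrm_smult[rotated])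
    also have "\<dots> = r / 2" using pos by (simp add: cmod_c)
    finally have "nrm V (c \<odot> x) < r" using r(1) by simp
    moreover have minus_zero: "\<ominus> \<zero> = \<zero>" by (rule M.minus_equality) auto
    have "c \<odot> x \<ominus> \<zero> = c \<odot> x" unfolding a_minus_def minus_zero using x c by simp
    ultimately have "nrm V (c \<odot> x \<ominus> \<zero>) < r" by simp
    then have "cmod (f (c \<odot> x)) < 1" using x c by (intro r(2)) auto
    also have "f (c \<odot> x) = c * f x" using f x c by (simp add: linear_functional_def)
    finally show ?thesis using pos r(1) by (simp add: norm_mult cmod_c field_simps)
  qed
  then show ?thesis by blast
qed

lemma bounded_imp_continuous_functional:
  assumes f: "linear_functional f" and C: "\<forall>x\<in>carrier V. cmod (f x) \<le> C * nrm V x"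
  shows "continuous_map (norm_topology V) (top_of_set K) f"
  unfolding continuous_map_in_subtopology
proof
  show "f \<in> topspace (norm_topology V) \<rightarrow> K" using f by (auto simp: linear_functional_def)
  show "continuous_map (norm_topology V) euclidean f"
    unfolding continuous_map_def
  proof (intro conjI allI impI)
    fix U :: "complex set" assume "openin euclidean U"
    then have U: "open U" by simp
    show "openin (norm_topology V) {x \<in> topspace (norm_topology V). f x \<in> U}"
      unfolding openin_norm_topology
    proof (intro conjI ballI)
      fix x assume "x \<in> {x \<in> topspace (norm_topology V). f x \<in> U}"
      then have x: "x \<in> carrier V" "f x \<in> U" by auto
      then obtain e where e: "e > 0" "ball (f x) e \<subseteq> U" using U openE by blast
      show "\<exists>r>0. \<forall>y\<in>carrier V. nrm V (y \<ominus> x) < r \<longrightarrow> y \<in> {x \<in> topspace (norm_topology V). f x \<in> U}"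
      proof (intro exI[of _ "e / (\<bar>C\<bar> + 1)"] conjI ballI impI)
        fix y assume y: "y \<in> carrier V" "nrm V (y \<ominus> x) < e / (\<bar>C\<bar> + 1)"
        have "dist (f x) (f y) = cmod (f (y \<ominus> x))"
          using linear_functional_diff[OF f y(1) x(1)] by (simp add: dist_norm norm_minus_commute)
        also have "\<dots> \<le> C * nrm V (y \<ominus> x)" using C x y by auto
        also have "\<dots> \<le> (\<bar>C\<bar> + 1) * nrm V (y \<ominus> x)" using x y by (intro mult_right_mono) auto
        also have "\<dots> < e" using y(2) by (simp add: field_simps)
        finally show "y \<in> {x \<in> topspace (norm_topology V). f x \<in> U}" using e(2) y by auto
      qed (use e in auto)
    qed auto
  qed auto
qed

lemma carrier_dual_iff:
  "f \<in> carrier (dual K V) \<longleftrightarrow>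
     f \<in> extensional (carrier V) \<and> linear_functional f \<and> (\<exists>C. \<forall>x\<in>carrier V. cmod (f x) \<le> C * nrm V x)"
  using continuous_imp_bounded_functional bounded_imp_continuous_functional
  by (auto simp: dual_def norm_topology_scalar_field linear_map_scalar_iff)

lemma dual_linear: "f \<in> carrier (dual K V) \<Longrightarrow> linear_functional f"
  by (simp add: carrier_dual_iff)

lemma dual_eqI:
  "f \<in> carrier (dual K V) \<Longrightarrow> g \<in> carrier (dual K V) \<Longrightarrow> (\<And>x. x \<in> carrier V \<Longrightarrow> f x = g x) \<Longrightarrow> f = g"
  by (auto simp: carrier_dual_iff intro: extensionalityI)

lemma zero_in_unit_ball: "\<zero> \<in> unit_ball V"
  by (simp add: unit_ball_def)

lemma dual_bdd_above:
  assumes "f \<in> carrier (dual K V)" shows "bdd_above ((\<lambda>x. cmod (f x)) ` unit_ball V)"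
proof -
  obtain C where C: "\<And>x. x \<in> carrier V \<Longrightarrow> cmod (f x) \<le> C * nrm V x"
    using assms by (auto simp: carrier_dual_iff)
  have "cmod (f x) \<le> \<bar>C\<bar>" if "x \<in> unit_ball V" for x
  proof -
    have x: "x \<in> carrier V" "nrm V x \<le> 1" "0 \<le> nrm V x" using that by (auto simp: unit_ball_def)
    have "cmod (f x) \<le> C * nrm V x" using C x by simp
    also have "\<dots> \<le> \<bar>C\<bar> * 1" using x by (intro mult_mono) auto
    finally show ?thesis by simp
  qed
  then show ?thesis by (rule bdd_aboveI2)
qed

lemma nrm_dual: "nrm (dual K V) f = (SUP x\<in>unit_ball V. cmod (f x))"
  by (simp add: dual_def)

lemma nrm_dual_nonneg: "f \<in> carrier (dual K V) \<Longrightarrow> 0 \<le> nrm (dual K V) f"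
  unfolding nrm_dual
  using cSUP_upper[OF zero_in_unit_ball dual_bdd_above, of f] norm_ge_zero[of "f \<zero>"] by linarith

lemma nrm_dual_le: "(\<And>x. x \<in> unit_ball V \<Longrightarrow> cmod (f x) \<le> C) \<Longrightarrow> nrm (dual K V) f \<le> C"
  unfolding nrm_dual using zero_in_unit_ball by (intro cSUP_least) auto

lemma dual_apply_le:
  assumes f: "f \<in> carrier (dual K V)" and x: "x \<in> carrier V"
  shows "cmod (f x) \<le> nrm (dual K V) f * nrm V x"
proof (cases "nrm V x = 0")
  case True
  then show ?thesis using linear_functional_zero[OF dual_linear[OF f]] x by (simp add: nrm_eq_zero_iff)
next
  case False
  then have pos: "nrm V x > 0" using nrm_nonneg[OF x] by simp
  define c where "c = complex_of_real (inverse (nrm V x))"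
  have c: "c \<in> K" unfolding c_def by (rule K_closed(1))
  have cmod_c: "cmod c = inverse (nrm V x)" unfolding c_def norm_of_real using pos by simp
  have "nrm V (c \<odot> x) = cmod c * nrm V x" using x c by (rule nrm_smult[rotated])
  then have "c \<odot> x \<in> unit_ball V" using x c pos by (simp add: unit_ball_def cmod_c)
  then have "cmod (f (c \<odot> x)) \<le> nrm (dual K V) f"
    unfolding nrm_dual by (intro cSUP_upper dual_bdd_above f)
  moreover have "f (c \<odot> x) = c * f x" using dual_linear[OF f] x c by (simp add: linear_functional_def)
  ultimately show ?thesis using pos by (simp add: norm_mult cmod_c field_simps)
qed

lemma dual_simps:
  "\<zero>\<^bsub>dual K V\<^esub> = (\<lambda>x\<in>carrier V. 0)"
  "f \<oplus>\<^bsub>dual K V\<^esub> g = (\<lambda>x\<in>carrier V. f x + g x)"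
  "c \<odot>\<^bsub>dual K V\<^esub> f = (\<lambda>x\<in>carrier V. c * f x)"
  by (simp_all add: dual_def)

lemma dual_add_closed:
  assumes "f \<in> carrier (dual K V)" "g \<in> carrier (dual K V)"
  shows "(\<lambda>x\<in>carrier V. f x + g x) \<in> carrier (dual K V)"
  unfolding carrier_dual_iff
proof (intro conjI)
  show "linear_functional (\<lambda>x\<in>carrier V. f x + g x)"
    using assms[THEN dual_linear] by (auto simp: linear_functional_def algebra_simps)
  have "cmod (f x + g x) \<le> (nrm (dual K V) f + nrm (dual K V) g) * nrm V x" if "x \<in> carrier V" for x
    using norm_triangle_ineq[of "f x" "g x"] dual_apply_le[OF assms(1) that] dual_apply_le[OF assms(2) that]
    by (simp add: algebra_simps)
  then show "\<exists>C. \<forall>x\<in>carrier V. cmod ((\<lambda>x\<in>carrier V. f x + g x) x) \<le> C * nrm V x"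
    by (intro exI ballI) auto
qed auto

lemma dual_smult_closed:
  assumes "c \<in> K" "f \<in> carrier (dual K V)"
  shows "(\<lambda>x\<in>carrier V. c * f x) \<in> carrier (dual K V)"
  unfolding carrier_dual_iff
proof (intro conjI)
  show "linear_functional (\<lambda>x\<in>carrier V. c * f x)"
    using assms(1) dual_linear[OF assms(2)] by (auto simp: linear_functional_def algebra_simps)
  have "cmod (c * f x) \<le> (cmod c * nrm (dual K V) f) * nrm V x" if "x \<in> carrier V" for x
    using mult_left_mono[OF dual_apply_le[OF assms(2) that], of "cmod c"] by (simp add: norm_mult mult.assoc)
  then show "\<exists>C. \<forall>x\<in>carrier V. cmod ((\<lambda>x\<in>carrier V. c * f x) x) \<le> C * nrm V x"
    by (intro exI ballI) auto
qed auto

lemma dual_zero_closed: "(\<lambda>x\<in>carrier V. 0) \<in> carrier (dual K V)"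
  unfolding carrier_dual_iff by (auto simp: linear_functional_def intro: exI[of _ 0])

lemma dual_module: "module (scalar_field K) (dual K V)"
proof (rule moduleI)
  let ?D = "carrier (dual K V)"
  show "cring (scalar_field K)" by (rule R.is_cring)
  show "abelian_group (dual K V)"
  proof (rule abelian_groupI; unfold dual_simps)
    fix f assume f: "f \<in> ?D"
    show "(\<lambda>x\<in>carrier V. (\<lambda>x\<in>carrier V. 0) x + f x) = f"
      using f by (intro dual_eqI dual_add_closed dual_zero_closed) auto
    show "\<exists>g\<in>?D. (\<lambda>x\<in>carrier V. g x + f x) = (\<lambda>x\<in>carrier V. 0)"
      using f by (intro bexI[of _ "\<lambda>x\<in>carrier V. (-1) * f x"] dual_smult_closed) auto
  qed (auto simp: dual_add_closed dual_zero_closed algebra_simps intro!: restrict_ext)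
next
  fix f assume f: "f \<in> carrier (dual K V)"
  then show "\<one>\<^bsub>scalar_field K\<^esub> \<odot>\<^bsub>dual K V\<^esub> f = f"
    unfolding dual_simps by (intro dual_eqI dual_smult_closed) auto
qed (auto simp: dual_simps dual_smult_closed algebra_simps intro!: restrict_ext)

lemma dual_normed_space_RC: "normed_space_RC K (dual K V)"
proof (intro normed_space_RC.intro normed_space.intro normed_space_axioms.intro normed_space_RC_axioms.intro
    dual_module scalars)
  fix f assume f: "f \<in> carrier (dual K V)"
  show "nrm (dual K V) f = 0 \<longleftrightarrow> f = \<zero>\<^bsub>dual K V\<^esub>"
  proof
    assume "nrm (dual K V) f = 0"
    then have "f x = 0" if "x \<in> carrier V" for x using dual_apply_le[OF f that] by simp
    then show "f = \<zero>\<^bsub>dual K V\<^esub>"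
      unfolding dual_simps by (intro dual_eqI f dual_zero_closed) auto
  next
    assume "f = \<zero>\<^bsub>dual K V\<^esub>"
    then have "nrm (dual K V) f \<le> 0" by (intro nrm_dual_le) (auto simp: dual_simps unit_ball_def)
    then show "nrm (dual K V) f = 0" using nrm_dual_nonneg[OF f] by simp
  qed
  have *: "nrm (dual K V) (c \<odot>\<^bsub>dual K V\<^esub> g) \<le> cmod c * nrm (dual K V) g"
    if g: "g \<in> carrier (dual K V)" for c g
  proof (rule nrm_dual_le)
    fix x assume x: "x \<in> unit_ball V"
    then have "cmod (g x) \<le> nrm (dual K V) g"
      unfolding nrm_dual by (intro cSUP_upper dual_bdd_above g)
    then show "cmod ((c \<odot>\<^bsub>dual K V\<^esub> g) x) \<le> cmod c * nrm (dual K V) g"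
      using x by (simp add: dual_simps unit_ball_def norm_mult mult_left_mono)
  qed
  show "nrm (dual K V) (c \<odot>\<^bsub>dual K V\<^esub> f) = cmod c * nrm (dual K V) f" if c: "c \<in> K" for c
  proof (cases "c = 0")
    case True
    have "c \<odot>\<^bsub>dual K V\<^esub> f \<in> carrier (dual K V)" unfolding dual_simps using c f by (rule dual_smult_closed)
    then show ?thesis using *[OF f, of c] nrm_dual_nonneg True by fastforce
  next
    case False
    have c': "inverse c \<in> K" using scalars c by (auto simp: Reals_inverse)
    have cf: "c \<odot>\<^bsub>dual K V\<^esub> f \<in> carrier (dual K V)" unfolding dual_simps using c f by (rule dual_smult_closed)
    have "inverse c \<odot>\<^bsub>dual K V\<^esub> (c \<odot>\<^bsub>dual K V\<^esub> f) = f"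
      using cf c c' f False unfolding dual_simps by (intro dual_eqI dual_smult_closed) auto
    then have "nrm (dual K V) f \<le> inverse (cmod c) * nrm (dual K V) (c \<odot>\<^bsub>dual K V\<^esub> f)"
      using *[OF cf, of "inverse c"] by (simp add: norm_inverse)
    then have "cmod c * nrm (dual K V) f \<le> nrm (dual K V) (c \<odot>\<^bsub>dual K V\<^esub> f)"
      using False by (simp add: field_simps)
    then show ?thesis using *[OF f, of c] by simp
  qed
  fix g assume g: "g \<in> carrier (dual K V)"
  show "nrm (dual K V) (f \<oplus>\<^bsub>dual K V\<^esub> g) \<le> nrm (dual K V) f + nrm (dual K V) g"
  proof (rule nrm_dual_le)
    fix x assume x: "x \<in> unit_ball V"
    then have "cmod (f x) \<le> nrm (dual K V) f" "cmod (g x) \<le> nrm (dual K V) g"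
      unfolding nrm_dual by (intro cSUP_upper dual_bdd_above f g; simp)+
    then show "cmod ((f \<oplus>\<^bsub>dual K V\<^esub> g) x) \<le> nrm (dual K V) f + nrm (dual K V) g"
      using x norm_triangle_ineq[of "f x" "g x"] by (simp add: dual_simps unit_ball_def)
  qed
qed

text \<open>
  This description by pointwise conditions on \<open>\<psi>\<close> is what makes the ball closed in a product space.
\<close>

lemma unit_ball_dual_iff:
  "\<psi> \<in> unit_ball (dual K V) \<longleftrightarrow>
     \<psi> \<in> extensional (carrier V) \<and> linear_functional \<psi> \<and> (\<forall>x\<in>carrier V. cmod (\<psi> x) \<le> nrm V x)"
proof
  assume "\<psi> \<in> unit_ball (dual K V)"
  then have \<psi>: "\<psi> \<in> carrier (dual K V)" "nrm (dual K V) \<psi> \<le> 1" by (auto simp: unit_ball_def)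
  have "cmod (\<psi> x) \<le> nrm V x" if "x \<in> carrier V" for x
    using dual_apply_le[OF \<psi>(1) that] mult_right_mono[OF \<psi>(2) nrm_nonneg[OF that]] by simp
  then show "\<psi> \<in> extensional (carrier V) \<and> linear_functional \<psi> \<and> (\<forall>x\<in>carrier V. cmod (\<psi> x) \<le> nrm V x)"
    using \<psi>(1) by (auto simp: carrier_dual_iff)
next
  assume \<psi>: "\<psi> \<in> extensional (carrier V) \<and> linear_functional \<psi> \<and> (\<forall>x\<in>carrier V. cmod (\<psi> x) \<le> nrm V x)"
  then have "\<psi> \<in> carrier (dual K V)" by (auto simp: carrier_dual_iff intro: exI[of _ 1])
  moreover have "nrm (dual K V) \<psi> \<le> 1"
    using \<psi> by (intro nrm_dual_le) (force simp: unit_ball_def)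
  ultimately show "\<psi> \<in> unit_ball (dual K V)" by (simp add: unit_ball_def)
qed

lemma weak_star_ball_eq:
  "weak_star_ball K V = subtopology (product_topology (\<lambda>_. top_of_set K) (carrier V)) (unit_ball (dual K V))"
  unfolding weak_star_ball_def weak_star_topology_def norm_topology_scalar_field subtopology_subtopology
  by (rule arg_cong[of _ _ "subtopology _"]) (auto simp: unit_ball_def)

lemma topspace_weak_star_ball: "topspace (weak_star_ball K V) = unit_ball (dual K V)"
  unfolding weak_star_ball_eq
  by (auto simp: unit_ball_dual_iff linear_functional_def PiE_def)

lemma continuous_map_product_eval:
  assumes "x \<in> carrier V"
  shows "continuous_map (product_topology (\<lambda>_. top_of_set K) (carrier V)) euclidean (\<lambda>\<psi>. \<psi> x)"
  using continuous_map_product_projection[OF assms, of "\<lambda>_. top_of_set K"]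
  by (simp add: continuous_map_in_subtopology)

lemma continuous_map_weak_star_eval:
  assumes "x \<in> carrier V"
  shows "continuous_map (weak_star_ball K V) euclidean (\<lambda>\<psi>. \<psi> x)"
  unfolding weak_star_ball_eq
  by (intro continuous_map_from_subtopology continuous_map_product_eval assms)

lemma Hausdorff_weak_star_ball: "Hausdorff_space (weak_star_ball K V)"
  unfolding weak_star_ball_eq
  by (intro Hausdorff_space_subtopology) (auto simp: Hausdorff_space_product_topology Hausdorff_space_subtopology)

text \<open>
  The theorem of Banach and Alaoglu. The ball consists of the points of a product of compact sets of scalars that satisfy the
  equations of linearity, each of which involves finitely many coordinates and so defines a closed set.
\<close>

lemma compact_weak_star_ball: "compact_space (weak_star_ball K V)"
proof -
  let ?P = "product_topology (\<lambda>_. top_of_set K) (carrier V)"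
  let ?C = "\<Pi>\<^sub>E x\<in>carrier V. K \<inter> cball 0 (nrm V x)"
  let ?add = "\<lambda>x y. {\<psi> \<in> topspace ?P. \<psi> (x \<oplus> y) - (\<psi> x + \<psi> y) \<in> {0}}"
  let ?smult = "\<lambda>c x. {\<psi> \<in> topspace ?P. \<psi> (c \<odot> x) - c * \<psi> x \<in> {0}}"
  let ?A = "\<Inter>x\<in>carrier V. \<Inter>y\<in>carrier V. ?add x y" and ?M = "\<Inter>c\<in>K. \<Inter>x\<in>carrier V. ?smult c x"
  have ne: "carrier V \<noteq> {}" "K \<noteq> {}" using M.zero_closed K_closed(2) by blast+
  have eval: "continuous_map ?P euclidean (\<lambda>\<psi>. \<psi> x)" if "x \<in> carrier V" for x
    using that by (rule continuous_map_product_eval)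
  have "compactin (top_of_set K) (K \<inter> cball 0 (nrm V x))" for x
    using closed_K by (auto simp: compactin_subtopology intro: closed_Int_compact)
  then have C: "compactin ?P ?C" by (simp add: compactin_PiE)
  have "closedin ?P (?add x y)" if "x \<in> carrier V" "y \<in> carrier V" for x y
    using that
    by (intro closedin_continuous_map_preimage[of _ euclidean] continuous_map_diff continuous_map_add eval) auto
  then have A: "closedin ?P ?A" using ne by (intro closedin_INT) auto
  have "closedin ?P (?smult c x)" if "c \<in> K" "x \<in> carrier V" for c x
  proof -
    have "continuous_map ?P euclidean ((*) c \<circ> (\<lambda>\<psi>. \<psi> x))"
      using that by (intro continuous_map_compose[OF eval]) (auto intro: continuous_intros)
    then show ?thesis
      using that by (intro closedin_continuous_map_preimage[of _ euclidean] continuous_map_diff eval) (auto simp: o_def)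
  qed
  then have M: "closedin ?P ?M" using ne by (intro closedin_INT) auto
  have "unit_ball (dual K V) = ?C \<inter> (?A \<inter> ?M)"
  proof (intro equalityI subsetI)
    fix \<psi> assume "\<psi> \<in> unit_ball (dual K V)"
    then show "\<psi> \<in> ?C \<inter> (?A \<inter> ?M)"
      by (auto simp: unit_ball_dual_iff linear_functional_def PiE_def)
  next
    fix \<psi> assume \<psi>: "\<psi> \<in> ?C \<inter> (?A \<inter> ?M)"
    then have "\<psi> x \<in> K" "cmod (\<psi> x) \<le> nrm V x" if "x \<in> carrier V" for x using that by auto
    moreover have "\<psi> (x \<oplus> y) = \<psi> x + \<psi> y" if "x \<in> carrier V" "y \<in> carrier V" for x y using \<psi> that by auto
    moreover have "\<psi> (c \<odot> x) = c * \<psi> x" if "c \<in> K" "x \<in> carrier V" for c x using \<psi> that by auto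
    moreover have "\<psi> \<in> extensional (carrier V)" using \<psi> by (auto simp: PiE_def)
    ultimately show "\<psi> \<in> unit_ball (dual K V)" by (simp add: unit_ball_dual_iff linear_functional_def)
  qed
  then have "compactin ?P (unit_ball (dual K V))"
    using C A M by (auto intro: compact_Int_closedin)
  then show ?thesis unfolding weak_star_ball_eq by (rule compact_space_subtopology)
qed

end

section \<open>Inequalities for finite sums\<close>

lemma conjugate_exponent_gt_1:
  fixes p q :: real
  assumes "1 < p" "1 / p + 1 / q = 1"
  shows "1 < q"
proof -
  have "0 < 1 / p" "1 / p < 1" using assms(1) by auto
  then have *: "0 < 1 / q" "1 / q < 1" using assms(2) by linarith+
  then have "0 < q" by (simp only: zero_less_divide_1_iff)
  with * show ?thesis by (simp add: divide_less_eq)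
qed

lemma Holder_inequality_finite_sum:
  fixes a b :: "'i \<Rightarrow> real"
  assumes p: "1 < p" and q: "1 / p + 1 / q = 1" and I: "finite I"
    and a: "\<And>i. i \<in> I \<Longrightarrow> 0 \<le> a i" and b: "\<And>i. i \<in> I \<Longrightarrow> 0 \<le> b i"
  shows "(\<Sum>i\<in>I. a i * b i) \<le> (\<Sum>i\<in>I. a i powr p) powr (1 / p) * (\<Sum>i\<in>I. b i powr q) powr (1 / q)"
proof -
  have q1: "1 < q" by (rule conjugate_exponent_gt_1[OF p q])
  let ?A = "(\<Sum>i\<in>I. a i powr p) powr (1 / p)" and ?B = "(\<Sum>i\<in>I. b i powr q) powr (1 / q)"
  show ?thesis
  proof (cases "?A = 0 \<or> ?B = 0")
    case True
    then have "(\<forall>i\<in>I. a i = 0) \<or> (\<forall>i\<in>I. b i = 0)"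
      using I by (auto simp: sum_nonneg_eq_0_iff)
    then have "(\<Sum>i\<in>I. a i * b i) = 0" by (auto intro: sum.neutral)
    then show ?thesis by simp
  next
    case False
    then have A: "?A > 0" and B: "?B > 0" by (metis less_eq_real_def powr_ge_zero)+
    have Ap: "?A powr p = (\<Sum>i\<in>I. a i powr p)" and Bq: "?B powr q = (\<Sum>i\<in>I. b i powr q)"
      using p q1 by (auto simp: powr_powr sum_nonneg)
    have "(\<Sum>i\<in>I. (a i / ?A) * (b i / ?B)) \<le> (\<Sum>i\<in>I. (a i / ?A) powr p / p + (b i / ?B) powr q / q)"
      using A B a b by (intro sum_mono Youngs_inequality p q1 q) auto
    also have "\<dots> = (\<Sum>i\<in>I. a i powr p / (?A powr p) / p + b i powr q / (?B powr q) / q)"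
      using A B a b by (intro sum.cong) (auto simp: powr_divide)
    also have "\<dots> = (\<Sum>i\<in>I. a i powr p) / (?A powr p) / p + (\<Sum>i\<in>I. b i powr q) / (?B powr q) / q"
      by (simp only: sum.distrib sum_divide_distrib)
    also have "\<dots> = 1"
    proof -
      have "?A powr p \<noteq> 0" "?B powr q \<noteq> 0" using A B by auto
      then show ?thesis unfolding Ap Bq using q by simp
    qed
    finally have "(\<Sum>i\<in>I. a i * b i) / (?A * ?B) \<le> 1"
      by (simp add: sum_divide_distrib)
    then show ?thesis using A B by (simp add: divide_le_eq)
  qed
qed

text \<open>
  The inequality between geometric and arithmetic mean, for the \<open>n\<close>-th powers of the \<open>u j\<close>.
\<close>

lemma prod_le_sum_powr_card:
  fixes u :: "nat \<Rightarrow> real"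
  assumes n: "1 \<le> n" and u: "\<And>j. j \<in> {1..n} \<Longrightarrow> 0 \<le> u j"
  shows "(\<Prod>j=1..n. u j) \<le> (\<Sum>j=1..n. u j powr n / n)"
proof -
  have "(\<Prod>j=1..n. u j powr n) powr (1 / n) = (\<Prod>j=1..n. (u j powr n) powr (1 / n))"
    by (rule prod_powr_distrib)
  also have "\<dots> = (\<Prod>j=1..n. u j)"
    using n u by (intro prod.cong) (auto simp: powr_powr)
  finally show ?thesis
    using arith_geom_mean[of "{1..n}" "\<lambda>j. u j powr n"] n by simp
qed

text \<open>
  Hoelder's inequality for \<open>n\<close> factors with all exponents equal to \<open>n\<close>. After normalization of each factor it
  reduces to the preceding inequality, summed over \<open>i\<close>.
\<close>

lemma sum_prod_le_prod_sum_powr: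
  fixes a :: "'i \<Rightarrow> nat \<Rightarrow> real"
  assumes n: "1 \<le> n" and I: "finite I"
    and a: "\<And>i j. i \<in> I \<Longrightarrow> j \<in> {1..n} \<Longrightarrow> 0 \<le> a i j"
  shows "(\<Sum>i\<in>I. \<Prod>j=1..n. a i j) \<le> (\<Prod>j=1..n. (\<Sum>i\<in>I. a i j powr n) powr (1 / n))"
proof -
  let ?A = "\<lambda>j. (\<Sum>i\<in>I. a i j powr n) powr (1 / n)"
  show ?thesis
  proof (cases "\<exists>j\<in>{1..n}. ?A j = 0")
    case True
    then obtain j where j: "j \<in> {1..n}" "?A j = 0" by blast
    then have "\<forall>i\<in>I. a i j = 0" using I by (auto simp: sum_nonneg_eq_0_iff)
    then have "(\<Prod>j=1..n. a i j) = 0" if "i \<in> I" for i using that j(1) by auto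
    then have "(\<Sum>i\<in>I. \<Prod>j=1..n. a i j) = 0" by (rule sum.neutral[OF ballI])
    then show ?thesis by (simp only: prod_nonneg powr_ge_zero)
  next
    case False
    then have A: "?A j > 0" if "j \<in> {1..n}" for j
      using that by (metis less_eq_real_def powr_ge_zero)
    then have PA: "(\<Prod>j=1..n. ?A j) > 0" by (intro prod_pos) auto
    have An: "?A j powr n = (\<Sum>i\<in>I. a i j powr n)" for j
      using n by (auto simp: powr_powr sum_nonneg)
    have "(\<Sum>i\<in>I. \<Prod>j=1..n. a i j) / (\<Prod>j=1..n. ?A j) = (\<Sum>i\<in>I. \<Prod>j=1..n. a i j / ?A j)"
      by (simp add: sum_divide_distrib prod_dividef)
    also have "\<dots> \<le> (\<Sum>i\<in>I. \<Sum>j=1..n. (a i j / ?A j) powr n / n)"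
      using a by (intro sum_mono prod_le_sum_powr_card n) auto
    also have "\<dots> = (\<Sum>i\<in>I. \<Sum>j=1..n. a i j powr n / (?A j powr n) / n)"
      using a by (intro sum.cong) (auto simp: powr_divide)
    also have "\<dots> = (\<Sum>j=1..n. (\<Sum>i\<in>I. a i j powr n) / (?A j powr n) / n)"
      by (subst sum.swap) (simp only: sum_divide_distrib)
    also have "\<dots> = (\<Sum>j=1..n. 1 / n)"
    proof (intro sum.cong refl)
      fix j assume "j \<in> {1..n}"
      then have "?A j powr n \<noteq> 0" using A[of j] by auto
      then show "(\<Sum>i\<in>I. a i j powr n) / (?A j powr n) / n = 1 / n" unfolding An by simp
    qed
    also have "\<dots> = 1" using n by simp
    finally show ?thesis using PA by (simp add: divide_le_eq)
  qed
qed

lemma prod_const_powr_inverse: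
  fixes t :: real and n :: nat
  assumes "1 \<le> n" "0 \<le> t"
  shows "(\<Prod>j=1..n. t powr (1 / n)) = t"
  using assms by (cases "t = 0") (auto simp: powr_realpow[symmetric] powr_powr power_0_left)


section \<open>The weak norm as a maximum over the bidual ball\<close>

context normed_space_RC
begin

lemma continuous_map_powr_eval:
  assumes "x \<in> carrier V" and "0 < q"
  shows "continuous_map (weak_star_ball K V) euclideanreal (\<lambda>\<psi>. cmod (\<psi> x) powr q)"
proof -
  have "continuous_on UNIV (\<lambda>z. cmod z powr q)"
    using assms(2) by (intro continuous_on_powr' continuous_intros) auto
  then have "continuous_map (weak_star_ball K V) euclideanreal ((\<lambda>z. cmod z powr q) \<circ> (\<lambda>\<psi>. \<psi> x))"
    by (intro continuous_map_compose[OF continuous_map_weak_star_eval[OF assms(1)]]) simp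
  then show ?thesis by (simp add: o_def)
qed

lemma zero_in_dual_ball: "(\<lambda>x\<in>carrier V. 0) \<in> unit_ball (dual K V)"
  by (auto simp: unit_ball_dual_iff linear_functional_def)

end

lemma weak_norm_ge:
  assumes Y: "normed_space_RC K Y" and q: "0 < q"
    and \<phi>: "\<And>i. i \<in> {1..m} \<Longrightarrow> \<phi> i \<in> carrier (dual K Y)"
    and \<psi>: "\<psi> \<in> unit_ball (dual K (dual K Y))"
  shows "(\<Sum>i=1..m. cmod (\<psi> (\<phi> i)) powr q) powr (1 / q) \<le> weak_norm K Y q m \<phi>"
proof -
  interpret normed_space_RC K "dual K Y" by (rule normed_space_RC.dual_normed_space_RC[OF Y])
  have "bdd_above ((\<lambda>\<psi>. (\<Sum>i=1..m. cmod (\<psi> (\<phi> i)) powr q) powr (1 / q)) ` unit_ball (dual K (dual K Y)))"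
  proof (rule bdd_aboveI2)
    fix \<psi> assume "\<psi> \<in> unit_ball (dual K (dual K Y))"
    then show "(\<Sum>i=1..m. cmod (\<psi> (\<phi> i)) powr q) powr (1 / q)
        \<le> (\<Sum>i=1..m. nrm (dual K Y) (\<phi> i) powr q) powr (1 / q)"
      using \<phi> q by (intro powr_mono2 sum_mono sum_nonneg) (auto simp: unit_ball_dual_iff)
  qed
  then show ?thesis unfolding weak_norm_def using \<psi> by (intro cSUP_upper)
qed

lemma weak_norm_nonneg:
  assumes Y: "normed_space_RC K Y" and q: "0 < q"
    and \<phi>: "\<And>i. i \<in> {1..m} \<Longrightarrow> \<phi> i \<in> carrier (dual K Y)"
  shows "0 \<le> weak_norm K Y q m \<phi>"
proof -
  interpret normed_space_RC K "dual K Y" by (rule normed_space_RC.dual_normed_space_RC[OF Y])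
  show ?thesis
    by (rule order_trans[OF powr_ge_zero weak_norm_ge[OF Y q \<phi> zero_in_dual_ball]])
qed

text \<open>
  The supremum over the bidual ball is a maximum because the ball is weak-star compact and the sum is a continuous
  function of \<open>\<psi>\<close>.
\<close>

lemma weak_norm_attained:
  assumes Y: "normed_space_RC K Y" and q: "0 < q"
    and \<phi>: "\<And>i. i \<in> {1..m} \<Longrightarrow> \<phi> i \<in> carrier (dual K Y)"
  obtains \<psi> where "\<psi> \<in> unit_ball (dual K (dual K Y))"
    "weak_norm K Y q m \<phi> powr q = (\<Sum>i=1..m. cmod (\<psi> (\<phi> i)) powr q)"
proof -
  interpret normed_space_RC K "dual K Y" by (rule normed_space_RC.dual_normed_space_RC[OF Y])
  let ?S = "weak_star_ball K (dual K Y)" and ?B = "unit_ball (dual K (dual K Y))"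
  let ?g = "\<lambda>\<psi>. \<Sum>i=1..m. cmod (\<psi> (\<phi> i)) powr q"
  have "continuous_map ?S euclideanreal ?g"
    using \<phi> q by (intro continuous_map_sum continuous_map_powr_eval) auto
  then have "compactin euclideanreal (?g ` topspace ?S)"
    using compact_weak_star_ball unfolding compact_space_def by (rule image_compactin[rotated])
  then have "compact (?g ` ?B)" by (simp add: topspace_weak_star_ball)
  moreover have "?g ` ?B \<noteq> {}" using zero_in_dual_ball by blast
  ultimately obtain \<psi> where \<psi>: "\<psi> \<in> ?B" "\<And>\<psi>'. \<psi>' \<in> ?B \<Longrightarrow> ?g \<psi>' \<le> ?g \<psi>"
    using compact_attains_sup[of "?g ` ?B"] by blast
  have "weak_norm K Y q m \<phi> \<le> ?g \<psi> powr (1 / q)"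
    unfolding weak_norm_def using \<psi> zero_in_dual_ball q
    by (intro cSUP_least powr_mono2) (auto intro: sum_nonneg)
  then have "weak_norm K Y q m \<phi> = ?g \<psi> powr (1 / q)"
    by (intro antisym weak_norm_ge[OF Y q _ \<psi>(1)] \<phi>)
  then have "weak_norm K Y q m \<phi> powr q = ?g \<psi>"
    using q by (simp add: powr_powr sum_nonneg)
  then show thesis using that \<psi>(1) by blast
qed


section \<open>Multilinear operators\<close>

text \<open>
  All analysis takes place on the bidual ball of \<open>Y\<close>; the operator \<open>T\<close> enters through the algebraic
  fact that \<open>\<phi> \<circ> T\<close> is homogeneous in each entry.
\<close>

locale multilinear_operator = Y: normed_space_RC K Y
  for K :: "complex set" and Y :: "'b normed_module" +
  fixes n :: nat and X :: "nat \<Rightarrow> 'a normed_module" and T :: "(nat \<Rightarrow> 'a) \<Rightarrow> 'b"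
  assumes n: "1 \<le> n"
    and X: "\<And>j. j \<in> {1..n} \<Longrightarrow> normed_space_RC K (X j)"
    and linear: "\<And>x j. x \<in> (\<Pi>\<^sub>E j\<in>{1..n}. carrier (X j)) \<Longrightarrow> j \<in> {1..n} \<Longrightarrow>
      linear_map K (X j) Y (\<lambda>v. T (x(j := v)))"
begin

definition point :: "(nat \<Rightarrow> 'a) \<Rightarrow> bool" where
  "point x \<longleftrightarrow> (\<forall>j\<in>{1..n}. x j \<in> carrier (X j))"

abbreviation app :: "('b \<Rightarrow> complex) \<Rightarrow> (nat \<Rightarrow> 'a) \<Rightarrow> complex" where
  "app \<phi> x \<equiv> \<phi> (T (\<lambda>j\<in>{1..n}. x j))"

abbreviation nrm_prod :: "(nat \<Rightarrow> 'a) \<Rightarrow> real" where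
  "nrm_prod x \<equiv> \<Prod>j=1..n. nrm (X j) (x j)"

lemma nrm_point: "point x \<Longrightarrow> j \<in> {1..n} \<Longrightarrow> 0 \<le> nrm (X j) (x j)"
  using normed_space_RC.nrm_nonneg[OF X] by (auto simp: point_def)

lemma nrm_prod_nonneg: "point x \<Longrightarrow> 0 \<le> nrm_prod x"
  by (intro prod_nonneg) (use nrm_point in auto)

lemma smult_point:
  assumes "point x" "\<And>j. j \<in> {1..n} \<Longrightarrow> c j \<in> K"
  shows "point (\<lambda>j. c j \<odot>\<^bsub>X j\<^esub> x j)"
  using assms normed_space_RC.smult_closed'[OF X] by (auto simp: point_def)

lemma T_closed:
  assumes "point x" shows "T (\<lambda>j\<in>{1..n}. x j) \<in> carrier Y"
proof -
  have "linear_map K (X 1) Y (\<lambda>v. T ((\<lambda>j\<in>{1..n}. x j)(1 := v)))"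
    using assms n by (intro linear) (auto simp: point_def)
  then have "T ((\<lambda>j\<in>{1..n}. x j)(1 := x 1)) \<in> carrier Y"
    using assms n by (auto simp: linear_map_def point_def)
  moreover have "(\<lambda>j\<in>{1..n}. x j)(1 := x 1) = (\<lambda>j\<in>{1..n}. x j)" using n by auto
  ultimately show ?thesis by simp
qed

text \<open>
  Induction over the set \<open>J\<close> of coordinates that have already been scaled.
\<close>

lemma app_smult:
  assumes \<phi>: "\<phi> \<in> carrier (dual K Y)" and x: "point x" and c: "\<And>j. j \<in> {1..n} \<Longrightarrow> c j \<in> K"
  shows "app \<phi> (\<lambda>j. c j \<odot>\<^bsub>X j\<^esub> x j) = (\<Prod>j=1..n. c j) * app \<phi> x"
proof -
  let ?x = "\<lambda>J j. if j \<in> J then c j \<odot>\<^bsub>X j\<^esub> x j else x j"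
  have "app \<phi> (?x J) = (\<Prod>j\<in>J. c j) * app \<phi> x" if "finite J" "J \<subseteq> {1..n}" for J
    using that
  proof (induction J rule: finite_induct)
    case (insert a J)
    let ?y = "\<lambda>j\<in>{1..n}. ?x J j"
    have a: "a \<in> {1..n}" "c a \<in> K" "x a \<in> carrier (X a)"
      using insert.prems c x by (auto simp: point_def)
    have "point (\<lambda>j. c j \<odot>\<^bsub>X j\<^esub> x j)" using x c by (rule smult_point)
    then have pt: "point (?x J)" using x by (auto simp: point_def)
    have "linear_map K (X a) Y (\<lambda>v. T (?y(a := v)))"
      using pt a by (intro linear) (auto simp: point_def)
    then have "T (?y(a := c a \<odot>\<^bsub>X a\<^esub> x a)) = c a \<odot>\<^bsub>Y\<^esub> T (?y(a := x a))"
      using a by (simp add: linear_map_def)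
    moreover have "?y(a := x a) = ?y" using insert.hyps a by auto
    moreover have "(\<lambda>j\<in>{1..n}. ?x (insert a J) j) = ?y(a := c a \<odot>\<^bsub>X a\<^esub> x a)"
      using a by (auto simp: fun_eq_iff)
    ultimately have "T (\<lambda>j\<in>{1..n}. ?x (insert a J) j) = c a \<odot>\<^bsub>Y\<^esub> T ?y" by simp
    then have step: "app \<phi> (?x (insert a J)) = c a * app \<phi> (?x J)"
      using Y.dual_linear[OF \<phi>] a T_closed[OF pt] by (simp add: Y.linear_functional_def)
    have IH: "app \<phi> (?x J) = (\<Prod>j\<in>J. c j) * app \<phi> x" using insert.IH insert.prems by blast
    show ?case unfolding step IH prod.insert[OF insert.hyps] by (rule mult.assoc[symmetric])
  qed simp
  from this[of "{1..n}"] have "app \<phi> (?x {1..n}) = (\<Prod>j=1..n. c j) * app \<phi> x" by simp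
  moreover have "(\<lambda>j\<in>{1..n}. ?x {1..n} j) = (\<lambda>j\<in>{1..n}. c j \<odot>\<^bsub>X j\<^esub> x j)" by auto
  ultimately show ?thesis by simp
qed

text \<open>
  Some entry of \<open>x\<close> is zero, i.e. unchanged by multiplication with the scalar zero, which can be taken out of \<open>\<phi> \<circ> T\<close>.
\<close>

lemma app_eq_0:
  assumes \<phi>: "\<phi> \<in> carrier (dual K Y)" and x: "point x" and 0: "nrm_prod x = 0"
  shows "app \<phi> x = 0"
proof -
  obtain k where k: "k \<in> {1..n}" "nrm (X k) (x k) = 0" using 0 by auto
  interpret Xk: normed_space_RC K "X k" by (rule X[OF k(1)])
  have xk: "x k \<in> carrier (X k)" using x k by (auto simp: point_def)
  then have zk: "x k = 0 \<odot>\<^bsub>X k\<^esub> x k"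
    using k(2) Xk.nrm_eq_zero_iff Xk.smult_zero_left by simp
  let ?c = "\<lambda>j. if j = k then 0 else 1 :: complex"
  have "?c j \<odot>\<^bsub>X j\<^esub> x j = x j" if j: "j \<in> {1..n}" for j
  proof -
    interpret Xj: normed_space_RC K "X j" by (rule X[OF j])
    show ?thesis using zk Xj.smult_one[of "x j"] x j by (auto simp: point_def)
  qed
  then have "(\<lambda>j\<in>{1..n}. ?c j \<odot>\<^bsub>X j\<^esub> x j) = (\<lambda>j\<in>{1..n}. x j)" by auto
  moreover have "(\<Prod>j=1..n. ?c j) = 0" using k by auto
  ultimately show ?thesis using app_smult[OF \<phi> x, of ?c] by simp
qed

text \<open>
  The scalars \<open>(r P)\<^sup>1\<^sup>/\<^sup>n / \<parallel>x\<^sub>j\<parallel>\<close>, with \<open>P\<close> the product of the norms \<open>\<parallel>x\<^sub>j\<parallel>\<close>, have product \<open>r\<close> and equalize the norms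
  if \<open>P\<close> is nonzero. If \<open>P = 0\<close>, both sides vanish.
  With \<open>r = 1\<close> this makes the two summing estimates comparable; other values of \<open>r\<close> weight the terms of a sum.
\<close>

lemma balanced_rescaling:
  assumes x: "point x" and r: "0 \<le> r"
  shows "\<exists>x'. point x' \<and> (\<forall>j\<in>{1..n}. nrm (X j) (x' j) = (r * nrm_prod x) powr (1 / n)) \<and>
    (\<forall>\<phi>\<in>carrier (dual K Y). app \<phi> x' = complex_of_real r * app \<phi> x)"
proof -
  \<comment> \<open>If the product of the norms is zero, the new entries are zero, and \<open>0 powr (1 / n) = 0\<close>.\<close>
  define s where "s j = (if nrm_prod x = 0 then 0 else (r * nrm_prod x) powr (1 / n) / nrm (X j) (x j))" for j
  define x' where "x' j = complex_of_real (s j) \<odot>\<^bsub>X j\<^esub> x j" for j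
  have K: "complex_of_real (s j) \<in> K" for j by simp
  show ?thesis
  proof (intro exI[of _ x'] conjI ballI)
    show "point x'" unfolding x'_def by (rule smult_point[OF x K])
    fix j assume j: "j \<in> {1..n}"
    interpret Xj: normed_space_RC K "X j" by (rule X[OF j])
    have "nrm (X j) (x' j) = \<bar>s j\<bar> * nrm (X j) (x j)"
      unfolding x'_def using Xj.nrm_smult[OF K, of "x j"] x j by (simp add: point_def)
    also have "\<dots> = (r * nrm_prod x) powr (1 / n)"
    proof (cases "nrm_prod x = 0")
      case False
      then have "nrm (X j) (x j) \<noteq> 0" using j by auto
      then show ?thesis using False nrm_point[OF x j] by (simp add: s_def)
    qed (simp add: s_def)
    finally show "nrm (X j) (x' j) = (r * nrm_prod x) powr (1 / n)" .
  next
    fix \<phi> assume \<phi>: "\<phi> \<in> carrier (dual K Y)"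
    show "app \<phi> x' = complex_of_real r * app \<phi> x"
    proof (cases "nrm_prod x = 0")
      case True
      then show ?thesis
        using app_eq_0[OF \<phi> x] app_smult[OF \<phi> x K] unfolding x'_def by simp
    next
      case False
      have "(\<Prod>j=1..n. (r * nrm_prod x) powr (1 / n)) = r * nrm_prod x"
        using n mult_nonneg_nonneg[OF r nrm_prod_nonneg[OF x]] by (rule prod_const_powr_inverse)
      then have "(\<Prod>j=1..n. s j) = r"
        using False by (simp add: s_def prod_dividef del: prod_constant)
      then have "(\<Prod>j=1..n. complex_of_real (s j)) = complex_of_real r" by (metis of_real_prod)
      then show ?thesis using app_smult[OF \<phi> x K] unfolding x'_def by simp
    qed
  qed
qed

subsection \<open>The two summing estimates and the domination by an integral\<close>

definition product_summing :: "real \<Rightarrow> real \<Rightarrow> real \<Rightarrow> bool" where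
  "product_summing p q C \<longleftrightarrow> (\<forall>(m::nat) x \<phi>.
     (\<forall>i\<in>{1..m}. \<forall>j\<in>{1..n}. x i j \<in> carrier (X j)) \<longrightarrow>
     (\<forall>i\<in>{1..m}. \<phi> i \<in> carrier (dual K Y)) \<longrightarrow>
     (\<Sum>i=1..m. cmod (\<phi> i (T (\<lambda>j\<in>{1..n}. x i j))))
       \<le> C * (\<Sum>i=1..m. \<Prod>j=1..n. nrm (X j) (x i j) powr p) powr (1 / p) * weak_norm K Y q m \<phi>)"

definition factorwise_summing :: "real \<Rightarrow> real \<Rightarrow> real \<Rightarrow> bool" where
  "factorwise_summing p q C \<longleftrightarrow> (\<forall>(m::nat) x \<phi>.
     (\<forall>i\<in>{1..m}. \<forall>j\<in>{1..n}. x i j \<in> carrier (X j)) \<longrightarrow>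
     (\<forall>i\<in>{1..m}. \<phi> i \<in> carrier (dual K Y)) \<longrightarrow>
     (\<Sum>i=1..m. cmod (\<phi> i (T (\<lambda>j\<in>{1..n}. x i j))))
       \<le> C * (\<Prod>j=1..n. (\<Sum>i=1..m. nrm (X j) (x i j) powr (real n * p)) powr (1 / (real n * p)))
           * weak_norm K Y q m \<phi>)"

definition dominated_by :: "real \<Rightarrow> real \<Rightarrow> (('b \<Rightarrow> complex) \<Rightarrow> complex) measure \<Rightarrow> bool" where
  "dominated_by q C \<mu> \<longleftrightarrow>
     prob_space \<mu> \<and> sets \<mu> = sets (borel_algebra (weak_star_ball K (dual K Y))) \<and>
     (\<forall>x \<phi>. (\<forall>j\<in>{1..n}. x j \<in> carrier (X j)) \<longrightarrow> \<phi> \<in> carrier (dual K Y) \<longrightarrow>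
       cmod (\<phi> (T (\<lambda>j\<in>{1..n}. x j)))
         \<le> C * (\<Prod>j=1..n. nrm (X j) (x j)) * (\<integral>\<psi>. cmod (\<psi> \<phi>) powr q \<partial>\<mu>) powr (1 / q))"

lemma nrm_prod_powr: "nrm_prod x powr p = (\<Prod>j=1..n. nrm (X j) (x j) powr p)"
  by (rule prod_powr_distrib)

lemma balanced_rescaling_family:
  assumes "\<And>i. i \<in> I \<Longrightarrow> point (x i)" "\<And>i. i \<in> I \<Longrightarrow> 0 \<le> r i"
  obtains x' where "\<And>i. i \<in> I \<Longrightarrow> point (x' i)"
    "\<And>i j. i \<in> I \<Longrightarrow> j \<in> {1..n} \<Longrightarrow> nrm (X j) (x' i j) = (r i * nrm_prod (x i)) powr (1 / n)"
    "\<And>i \<phi>. i \<in> I \<Longrightarrow> \<phi> \<in> carrier (dual K Y) \<Longrightarrow> app \<phi> (x' i) = complex_of_real (r i) * app \<phi> (x i)"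
proof -
  let ?P = "\<lambda>i x'. point x' \<and> (\<forall>j\<in>{1..n}. nrm (X j) (x' j) = (r i * nrm_prod (x i)) powr (1 / n)) \<and>
    (\<forall>\<phi>\<in>carrier (dual K Y). app \<phi> x' = complex_of_real (r i) * app \<phi> (x i))"
  define x' where "x' i = (SOME x'. ?P i x')" for i
  have "?P i (x' i)" if "i \<in> I" for i
    unfolding x'_def by (rule someI_ex[OF balanced_rescaling[OF assms(1)[OF that] assms(2)[OF that]]])
  then show thesis by (intro that[of x']) auto
qed

lemma product_summingD:
  assumes "product_summing p q C"
    and "\<And>i. i \<in> {1..m} \<Longrightarrow> point (x i)" "\<And>i. i \<in> {1..m} \<Longrightarrow> \<phi> i \<in> carrier (dual K Y)"
  shows "(\<Sum>i=1..m. cmod (app (\<phi> i) (x i)))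
    \<le> C * (\<Sum>i=1..m. nrm_prod (x i) powr p) powr (1 / p) * weak_norm K Y q m \<phi>"
  using assms unfolding product_summing_def point_def nrm_prod_powr by blast

lemma product_summing_imp_factorwise_summing:
  assumes p: "1 < p" and q: "1 / p + 1 / q = 1" and C: "0 < C" "product_summing p q C"
  shows "factorwise_summing p q C"
  unfolding factorwise_summing_def
proof (intro allI impI)
  fix m :: nat and x :: "nat \<Rightarrow> nat \<Rightarrow> 'a" and \<phi> :: "nat \<Rightarrow> 'b \<Rightarrow> complex"
  assume "\<forall>i\<in>{1..m}. \<forall>j\<in>{1..n}. x i j \<in> carrier (X j)" and "\<forall>i\<in>{1..m}. \<phi> i \<in> carrier (dual K Y)"
  then have x: "\<And>i. i \<in> {1..m} \<Longrightarrow> point (x i)" and \<phi>: "\<And>i. i \<in> {1..m} \<Longrightarrow> \<phi> i \<in> carrier (dual K Y)"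
    by (auto simp: point_def)
  let ?N = "\<lambda>i j. nrm (X j) (x i j)"
  have w: "0 \<le> weak_norm K Y q m \<phi>"
    using conjugate_exponent_gt_1[OF p q] by (intro weak_norm_nonneg Y.normed_space_RC_axioms \<phi>) auto
  have "(\<Sum>i=1..m. \<Prod>j=1..n. ?N i j powr p) \<le> (\<Prod>j=1..n. (\<Sum>i=1..m. (?N i j powr p) powr n) powr (1 / n))"
    using n by (intro sum_prod_le_prod_sum_powr) auto
  then have "(\<Sum>i=1..m. nrm_prod (x i) powr p) powr (1 / p)
      \<le> (\<Prod>j=1..n. (\<Sum>i=1..m. (?N i j powr p) powr n) powr (1 / n)) powr (1 / p)"
    unfolding nrm_prod_powr using p by (intro powr_mono2 sum_nonneg prod_nonneg) auto
  also have "\<dots> = (\<Prod>j=1..n. (\<Sum>i=1..m. ?N i j powr (real n * p)) powr (1 / (real n * p)))"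
    unfolding prod_powr_distrib by (simp add: powr_powr mult.commute)
  finally have le: "(\<Sum>i=1..m. nrm_prod (x i) powr p) powr (1 / p)
      \<le> (\<Prod>j=1..n. (\<Sum>i=1..m. ?N i j powr (real n * p)) powr (1 / (real n * p)))" .
  have "(\<Sum>i=1..m. cmod (app (\<phi> i) (x i)))
      \<le> C * (\<Sum>i=1..m. nrm_prod (x i) powr p) powr (1 / p) * weak_norm K Y q m \<phi>"
    by (intro product_summingD C x \<phi>)
  also have "\<dots> \<le> C * (\<Prod>j=1..n. (\<Sum>i=1..m. ?N i j powr (real n * p)) powr (1 / (real n * p))) * weak_norm K Y q m \<phi>"
    using C w by (intro mult_right_mono mult_left_mono le) auto
  finally show "(\<Sum>i=1..m. cmod (app (\<phi> i) (x i)))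
      \<le> C * (\<Prod>j=1..n. (\<Sum>i=1..m. ?N i j powr (real n * p)) powr (1 / (real n * p))) * weak_norm K Y q m \<phi>" .
qed

text \<open>
  After a balanced rescaling with \<open>r = 1\<close> every factor on the right contains the same sum.
\<close>

lemma factorwise_summing_imp_product_summing:
  assumes p: "1 < p" and C: "factorwise_summing p q C"
  shows "product_summing p q C"
  unfolding product_summing_def
proof (intro allI impI)
  fix m :: nat and x :: "nat \<Rightarrow> nat \<Rightarrow> 'a" and \<phi> :: "nat \<Rightarrow> 'b \<Rightarrow> complex"
  assume "\<forall>i\<in>{1..m}. \<forall>j\<in>{1..n}. x i j \<in> carrier (X j)" and \<phi>: "\<forall>i\<in>{1..m}. \<phi> i \<in> carrier (dual K Y)"
  then have x: "\<And>i. i \<in> {1..m} \<Longrightarrow> point (x i)"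
    by (auto simp: point_def)
  obtain x' where "\<And>i. i \<in> {1..m} \<Longrightarrow> point (x' i)"
    "\<And>i j. i \<in> {1..m} \<Longrightarrow> j \<in> {1..n} \<Longrightarrow> nrm (X j) (x' i j) = (1 * nrm_prod (x i)) powr (1 / n)"
    "\<And>i \<phi>. i \<in> {1..m} \<Longrightarrow> \<phi> \<in> carrier (dual K Y) \<Longrightarrow> app \<phi> (x' i) = complex_of_real 1 * app \<phi> (x i)"
    using balanced_rescaling_family[of "{1..m}" x "\<lambda>_. 1", OF x zero_le_one] by blast
  note x' = this[unfolded mult_1 of_real_1]
  have "(\<Sum>i=1..m. cmod (app (\<phi> i) (x i))) = (\<Sum>i=1..m. cmod (app (\<phi> i) (x' i)))"
    by (intro sum.cong refl arg_cong[of _ _ cmod] x'(3)[symmetric]) (use \<phi> in auto)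
  also have "\<dots> \<le> C * (\<Prod>j=1..n. (\<Sum>i=1..m. nrm (X j) (x' i j) powr (real n * p)) powr (1 / (real n * p)))
      * weak_norm K Y q m \<phi>"
    using C x'(1) \<phi> unfolding factorwise_summing_def point_def by blast
  also have "(\<Prod>j=1..n. (\<Sum>i=1..m. nrm (X j) (x' i j) powr (real n * p)) powr (1 / (real n * p)))
      = (\<Prod>j=1..n. (\<Sum>i=1..m. nrm_prod (x i) powr p) powr (1 / (real n * p)))"
  proof (intro prod.cong refl)
    fix j assume j: "j \<in> {1..n}"
    have "nrm (X j) (x' i j) powr (real n * p) = nrm_prod (x i) powr p" if "i \<in> {1..m}" for i
      unfolding x'(2)[OF that j] using n by (simp add: powr_powr)
    then have "(\<Sum>i=1..m. nrm (X j) (x' i j) powr (real n * p)) = (\<Sum>i=1..m. nrm_prod (x i) powr p)"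
      by (intro sum.cong refl)
    then show "(\<Sum>i=1..m. nrm (X j) (x' i j) powr (real n * p)) powr (1 / (real n * p))
        = (\<Sum>i=1..m. nrm_prod (x i) powr p) powr (1 / (real n * p))"
      by (simp only:)
  qed
  also have "\<dots> = ((\<Sum>i=1..m. nrm_prod (x i) powr p) powr (1 / p))"
    using prod_const_powr_inverse[OF n, of "(\<Sum>i=1..m. nrm_prod (x i) powr p) powr (1 / p)"]
    by (simp add: powr_powr mult.commute)
  finally show "(\<Sum>i=1..m. cmod (app (\<phi> i) (x i)))
      \<le> C * (\<Sum>i=1..m. \<Prod>j=1..n. nrm (X j) (x i j) powr p) powr (1 / p) * weak_norm K Y q m \<phi>"
    unfolding nrm_prod_powr .
qed

text \<open>
  With \<open>b i\<close> the \<open>L\<^sup>q\<close> norm of the evaluation at \<open>\<phi> i\<close>, the sum of the \<open>b i powr q\<close> is the integral of a function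
  bounded by the \<open>q\<close>-th power of the weak norm.
\<close>

lemma dominated_imp_product_summing:
  assumes p: "1 < p" and q: "1 / p + 1 / q = 1" and C: "0 < C" "dominated_by q C \<mu>"
  shows "product_summing p q C"
  unfolding product_summing_def
proof (intro allI impI)
  fix m :: nat and x :: "nat \<Rightarrow> nat \<Rightarrow> 'a" and \<phi> :: "nat \<Rightarrow> 'b \<Rightarrow> complex"
  assume "\<forall>i\<in>{1..m}. \<forall>j\<in>{1..n}. x i j \<in> carrier (X j)" and "\<forall>i\<in>{1..m}. \<phi> i \<in> carrier (dual K Y)"
  then have x: "\<And>i. i \<in> {1..m} \<Longrightarrow> point (x i)" and \<phi>: "\<And>i. i \<in> {1..m} \<Longrightarrow> \<phi> i \<in> carrier (dual K Y)"
    by (auto simp: point_def)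
  interpret D: normed_space_RC K "dual K Y" by (rule Y.dual_normed_space_RC)
  let ?S = "weak_star_ball K (dual K Y)"
  let ?w = "weak_norm K Y q m \<phi>"
  have q0: "0 < q" using conjugate_exponent_gt_1[OF p q] by simp
  have \<mu>: "prob_space \<mu>" "sets \<mu> = sets (borel_algebra ?S)"
    and dom: "\<And>x \<phi>. point x \<Longrightarrow> \<phi> \<in> carrier (dual K Y) \<Longrightarrow>
      cmod (app \<phi> x) \<le> C * nrm_prod x * (\<integral>\<psi>. cmod (\<psi> \<phi>) powr q \<partial>\<mu>) powr (1 / q)"
    using C(2) by (auto simp: dominated_by_def point_def)
  interpret \<mu>: prob_space \<mu> by (rule \<mu>(1))
  have space: "space \<mu> = unit_ball (dual K (dual K Y))"
    using sets_eq_imp_space_eq[OF \<mu>(2)] by (simp add: space_borel_algebra D.topspace_weak_star_ball)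
  have w: "0 \<le> ?w" using q0 by (intro weak_norm_nonneg Y.normed_space_RC_axioms \<phi>)
  have int: "integrable \<mu> (\<lambda>\<psi>. cmod (\<psi> (\<phi> i)) powr q)" if "i \<in> {1..m}" for i
    using that by (intro integrable_continuous_map_compact[OF \<mu> D.compact_weak_star_ball]
        D.continuous_map_powr_eval \<phi> q0)
  define b where "b i = (\<integral>\<psi>. cmod (\<psi> (\<phi> i)) powr q \<partial>\<mu>) powr (1 / q)" for i
  have bq: "b i powr q = (\<integral>\<psi>. cmod (\<psi> (\<phi> i)) powr q \<partial>\<mu>)" for i
    unfolding b_def using q0 by (simp add: powr_powr)
  have "(\<Sum>i=1..m. b i powr q) = (\<integral>\<psi>. (\<Sum>i=1..m. cmod (\<psi> (\<phi> i)) powr q) \<partial>\<mu>)"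
    unfolding bq by (rule Bochner_Integration.integral_sum[symmetric]) (rule int)
  also have "\<dots> \<le> (\<integral>\<psi>. ?w powr q \<partial>\<mu>)"
  proof (intro integral_mono Bochner_Integration.integrable_sum int)
    fix \<psi> assume "\<psi> \<in> space \<mu>"
    then have "(\<Sum>i=1..m. cmod (\<psi> (\<phi> i)) powr q) powr (1 / q) \<le> ?w"
      using q0 space by (intro weak_norm_ge Y.normed_space_RC_axioms \<phi>) auto
    then have "((\<Sum>i=1..m. cmod (\<psi> (\<phi> i)) powr q) powr (1 / q)) powr q \<le> ?w powr q"
      using q0 by (intro powr_mono2) auto
    then show "(\<Sum>i=1..m. cmod (\<psi> (\<phi> i)) powr q) \<le> ?w powr q"
      using q0 by (simp add: powr_powr sum_nonneg)
  qed auto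
  also have "\<dots> = ?w powr q" by (simp add: \<mu>.prob_space)
  finally have "(\<Sum>i=1..m. b i powr q) powr (1 / q) \<le> (?w powr q) powr (1 / q)"
    using q0 by (intro powr_mono2 sum_nonneg) auto
  then have b_le: "(\<Sum>i=1..m. b i powr q) powr (1 / q) \<le> ?w"
    using q0 w by (simp add: powr_powr)
  have "(\<Sum>i=1..m. cmod (app (\<phi> i) (x i))) \<le> (\<Sum>i=1..m. C * (nrm_prod (x i) * b i))"
    using dom[OF x \<phi>] by (intro sum_mono) (simp add: b_def mult.assoc)
  also have "\<dots> = C * (\<Sum>i=1..m. nrm_prod (x i) * b i)" by (rule sum_distrib_left[symmetric])
  also have "\<dots> \<le> C * ((\<Sum>i=1..m. nrm_prod (x i) powr p) powr (1 / p) * (\<Sum>i=1..m. b i powr q) powr (1 / q))"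
    using C(1) nrm_prod_nonneg[OF x] by (intro mult_left_mono Holder_inequality_finite_sum p q) (auto simp: b_def)
  also have "\<dots> \<le> C * ((\<Sum>i=1..m. nrm_prod (x i) powr p) powr (1 / p) * ?w)"
    using C(1) by (intro mult_left_mono b_le) auto
  finally show "(\<Sum>i=1..m. cmod (app (\<phi> i) (x i)))
      \<le> C * (\<Sum>i=1..m. \<Prod>j=1..n. nrm (X j) (x i j) powr p) powr (1 / p) * ?w"
    unfolding nrm_prod_powr by (simp add: mult.assoc)
qed

text \<open>
  With \<open>b i\<close> the \<open>i\<close>-th term on the left without its exponent, scaling the \<open>i\<close>-th tuple by \<open>b i powr (q - 1)\<close>
  turns the left side of the summing estimate into \<open>B = \<Sum>\<^sub>i b\<^sub>i\<^sup>q\<close>. As \<open>(q - 1) p = q\<close>, the right side becomes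
  at most \<open>C B\<^sup>1\<^sup>/\<^sup>p w\<close> with \<open>w\<close> the weak norm, and dividing by \<open>B\<^sup>1\<^sup>/\<^sup>p\<close> leaves \<open>B\<^sup>1\<^sup>/\<^sup>q \<le> C w\<close>.
\<close>

lemma product_summing_imp_power_estimate:
  assumes p: "1 < p" and q: "1 / p + 1 / q = 1" and C: "0 < C" "product_summing p q C"
    and x: "\<And>i. i \<in> {1..m} \<Longrightarrow> point (x i)" "\<And>i. i \<in> {1..m} \<Longrightarrow> nrm_prod (x i) \<le> 1"
    and \<phi>: "\<And>i. i \<in> {1..m} \<Longrightarrow> \<phi> i \<in> carrier (dual K Y)"
  shows "(\<Sum>i=1..m. cmod (app (\<phi> i) (x i)) powr q) \<le> C powr q * weak_norm K Y q m \<phi> powr q"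
proof -
  let ?w = "weak_norm K Y q m \<phi>"
  define b where "b i = cmod (app (\<phi> i) (x i))" for i
  define B where "B = (\<Sum>i=1..m. b i powr q)"
  have q1: "1 < q" by (rule conjugate_exponent_gt_1[OF p q])
  have pq: "(q - 1) * p = q" using p q1 q by (simp add: field_simps)
  have B0: "0 \<le> B" unfolding B_def by (intro sum_nonneg) auto
  have w: "0 \<le> ?w" using q1 by (intro weak_norm_nonneg Y.normed_space_RC_axioms \<phi>) auto
  obtain x' where x': "\<And>i. i \<in> {1..m} \<Longrightarrow> point (x' i)"
    "\<And>i j. i \<in> {1..m} \<Longrightarrow> j \<in> {1..n} \<Longrightarrow> nrm (X j) (x' i j) = (b i powr (q - 1) * nrm_prod (x i)) powr (1 / n)"
    "\<And>i \<phi>. i \<in> {1..m} \<Longrightarrow> \<phi> \<in> carrier (dual K Y) \<Longrightarrow>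
      app \<phi> (x' i) = complex_of_real (b i powr (q - 1)) * app \<phi> (x i)"
    using balanced_rescaling_family[of "{1..m}" x "\<lambda>i. b i powr (q - 1)", OF x(1) powr_ge_zero] by blast
  have nrm_prod_x': "nrm_prod (x' i) powr p \<le> b i powr q" if i: "i \<in> {1..m}" for i
  proof -
    let ?t = "b i powr (q - 1) * nrm_prod (x i)"
    have t: "0 \<le> ?t" using nrm_prod_nonneg[OF x(1)[OF i]] by simp
    have "nrm_prod (x' i) = (\<Prod>j=1..n. ?t powr (1 / n))" using x'(2)[OF i] by (intro prod.cong) auto
    also have "\<dots> = ?t" using n t by (rule prod_const_powr_inverse)
    also have "\<dots> \<le> b i powr (q - 1) * 1" using x(2)[OF i] by (intro mult_left_mono) auto
    finally have "nrm_prod (x' i) powr p \<le> (b i powr (q - 1)) powr p"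
      using p nrm_prod_nonneg[OF x'(1)[OF i]] by (intro powr_mono2) auto
    then show ?thesis by (simp add: powr_powr pq)
  qed
  have "B = (\<Sum>i=1..m. cmod (app (\<phi> i) (x' i)))"
    unfolding B_def
  proof (intro sum.cong refl)
    fix i assume i: "i \<in> {1..m}"
    have "cmod (app (\<phi> i) (x' i)) = b i powr (q - 1) * b i"
      using x'(3)[OF i \<phi>[OF i]] by (simp add: norm_mult b_def)
    also have "\<dots> = b i powr q"
      using powr_mult_base[of "b i" "q - 1"] by (simp add: b_def mult.commute)
    finally show "b i powr q = cmod (app (\<phi> i) (x' i))" by simp
  qed
  also have "\<dots> \<le> C * (\<Sum>i=1..m. nrm_prod (x' i) powr p) powr (1 / p) * ?w"
    by (intro product_summingD C x' \<phi>)
  also have "\<dots> \<le> C * B powr (1 / p) * ?w"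
    unfolding B_def using C(1) w p
    by (intro mult_right_mono mult_left_mono powr_mono2 sum_mono nrm_prod_x' sum_nonneg) auto
  finally have le: "B \<le> C * B powr (1 / p) * ?w" .
  have "B powr (1 / q) \<le> C * ?w"
  proof (cases "B = 0")
    case True
    then show ?thesis using C(1) w by simp
  next
    case False
    then have pos: "0 < B powr (1 / p)" using B0 by simp
    have "B powr (1 / q) * B powr (1 / p) = B powr (1 / p + 1 / q)" by (simp add: powr_add)
    also have "\<dots> = B" using q B0 by simp
    also have "\<dots> \<le> (C * ?w) * B powr (1 / p)" using le by (simp add: ac_simps)
    finally show ?thesis using pos by (rule mult_right_le_imp_le)
  qed
  then have "(B powr (1 / q)) powr q \<le> (C * ?w) powr q" using q1 by (intro powr_mono2) auto
  then show ?thesis using q1 B0 C(1) w by (simp add: powr_powr powr_mult B_def b_def)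
qed

text \<open>
  The domination theorem of Pietsch: the power estimate is the hypothesis of the separation theorem for the
  multiples of the functions \<open>\<psi> \<mapsto> C\<^sup>q |\<psi>(\<phi>)|\<^sup>q - |\<phi>(T x)|\<^sup>q\<close>.
\<close>

lemma product_summing_imp_dominated:
  assumes p: "1 < p" and q: "1 / p + 1 / q = 1" and C: "0 < C" "product_summing p q C"
  shows "\<exists>\<mu>. dominated_by q C \<mu>"
proof -
  interpret D: normed_space_RC K "dual K Y" by (rule Y.dual_normed_space_RC)
  let ?S = "weak_star_ball K (dual K Y)"
  have q1: "1 < q" by (rule conjugate_exponent_gt_1[OF p q])
  let ?h = "\<lambda>c \<phi> x \<psi>. c * (C powr q * cmod (\<psi> \<phi>) powr q - cmod (app \<phi> x) powr q)"
  define Z where "Z = {(c, \<phi>, x). (0::real) < c \<and> \<phi> \<in> carrier (dual K Y) \<and> point x \<and> nrm_prod x \<le> 1}"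
  define H where "H = (\<lambda>(c, \<phi>, x). ?h c \<phi> x) ` Z"
  have "\<exists>\<mu>. prob_space \<mu> \<and> sets \<mu> = sets (borel_algebra ?S) \<and> (\<forall>h\<in>H. 0 \<le> (\<integral>\<psi>. h \<psi> \<partial>\<mu>))"
  proof (rule ex_borel_measure_nonneg_on_cone[OF D.compact_weak_star_ball D.Hausdorff_weak_star_ball])
    show "continuous_map ?S euclideanreal h" if h: "h \<in> H" for h
    proof -
      obtain c \<phi> x where "h = ?h c \<phi> x" "\<phi> \<in> carrier (dual K Y)" using h unfolding H_def Z_def by auto
      then show ?thesis
        using q1 by (auto intro!: continuous_map_real_mult continuous_map_diff D.continuous_map_powr_eval)
    qed
    show "(\<lambda>\<psi>. c * h \<psi>) \<in> H" if c: "0 < c" and h: "h \<in> H" for c h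
    proof -
      obtain d \<phi> x where "(d, \<phi>, x) \<in> Z" and h_eq: "h = ?h d \<phi> x" using h unfolding H_def by auto
      then have "(c * d, \<phi>, x) \<in> Z" using c by (auto simp: Z_def)
      moreover have "(\<lambda>\<psi>. c * h \<psi>) = ?h (c * d) \<phi> x" unfolding h_eq by (simp add: mult.assoc)
      ultimately show ?thesis unfolding H_def by (intro image_eqI[of _ _ "(c * d, \<phi>, x)"]) auto
    qed
    fix hs assume "hs \<in> lists H"
    then obtain zs where zs: "zs \<in> lists Z" and hs: "hs = map (\<lambda>(c, \<phi>, x). ?h c \<phi> x) zs"
      unfolding H_def lists_image by blast
    let ?m = "length zs"
    define c where "c i = fst (zs ! (i - 1))" for i
    define \<phi> where "\<phi> i = fst (snd (zs ! (i - 1)))" for i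
    define x where "x i = snd (snd (zs ! (i - 1)))" for i
    have Z: "(c i, \<phi> i, x i) \<in> Z" if "i \<in> {1..?m}" for i
    proof -
      have "zs ! (i - 1) \<in> Z" using that zs by (auto simp: in_lists_conv_set)
      then show ?thesis by (simp add: c_def \<phi>_def x_def)
    qed
    have hs_eq: "hs ! (i - 1) = ?h (c i) (\<phi> i) (x i)" if "i \<in> {1..?m}" for i
      using that by (auto simp: hs c_def \<phi>_def x_def split_beta)
    have c: "\<And>i. i \<in> {1..?m} \<Longrightarrow> 0 < c i" and \<phi>: "\<And>i. i \<in> {1..?m} \<Longrightarrow> \<phi> i \<in> carrier (dual K Y)"
      and x: "\<And>i. i \<in> {1..?m} \<Longrightarrow> point (x i)" "\<And>i. i \<in> {1..?m} \<Longrightarrow> nrm_prod (x i) \<le> 1"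
      using Z unfolding Z_def by auto
    \<comment> \<open>The factor \<open>c i\<close> is absorbed into the functional, both sides being homogeneous of degree \<open>q\<close> in it.\<close>
    define r where "r i = c i powr (1 / q)" for i
    have rq: "r i powr q = c i" if "i \<in> {1..?m}" for i
      using c[OF that] q1 by (simp add: r_def powr_powr)
    have r0: "0 \<le> r i" for i by (simp add: r_def)
    define \<phi>' where "\<phi>' i = complex_of_real (r i) \<odot>\<^bsub>dual K Y\<^esub> \<phi> i" for i
    have \<phi>': "\<phi>' i \<in> carrier (dual K Y)" if "i \<in> {1..?m}" for i
      unfolding \<phi>'_def using \<phi>[OF that] by (intro D.smult_closed') auto
    have app': "cmod (app (\<phi>' i) (x i)) powr q = c i * cmod (app (\<phi> i) (x i)) powr q" if i: "i \<in> {1..?m}" for i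
      using T_closed[OF x(1)[OF i]] r0 rq[OF i]
      by (simp add: \<phi>'_def Y.dual_simps norm_mult powr_mult)
    obtain \<psi> where \<psi>: "\<psi> \<in> unit_ball (dual K (dual K Y))"
      "weak_norm K Y q ?m \<phi>' powr q = (\<Sum>i=1..?m. cmod (\<psi> (\<phi>' i)) powr q)"
      using weak_norm_attained[OF Y.normed_space_RC_axioms _ \<phi>', of q ?m "\<lambda>i. i"] q1 by auto
    have \<psi>': "cmod (\<psi> (\<phi>' i)) powr q = c i * cmod (\<psi> (\<phi> i)) powr q" if i: "i \<in> {1..?m}" for i
    proof -
      have "\<psi> (\<phi>' i) = complex_of_real (r i) * \<psi> (\<phi> i)"
        using \<psi>(1) \<phi>[OF i] unfolding \<phi>'_def by (simp add: D.unit_ball_dual_iff D.linear_functional_def)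
      then show ?thesis using r0 rq[OF i] by (simp add: norm_mult powr_mult)
    qed
    have "(\<Sum>i=1..?m. cmod (app (\<phi>' i) (x i)) powr q) \<le> C powr q * (\<Sum>i=1..?m. cmod (\<psi> (\<phi>' i)) powr q)"
      using product_summing_imp_power_estimate[OF p q C x \<phi>', of ?m "\<lambda>i. i" "\<lambda>i. i"] \<psi>(2) by simp
    then have "(\<Sum>i=1..?m. c i * cmod (app (\<phi> i) (x i)) powr q) \<le> C powr q * (\<Sum>i=1..?m. c i * cmod (\<psi> (\<phi> i)) powr q)"
      using app' \<psi>' by simp
    then have "0 \<le> (\<Sum>i=1..?m. ?h (c i) (\<phi> i) (x i) \<psi>)"
      by (simp add: right_diff_distrib sum_subtractf sum_distrib_left mult.left_commute)
    also have "\<dots> = (\<Sum>i=1..?m. (hs ! (i - 1)) \<psi>)" using hs_eq by (intro sum.cong) auto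
    also have "\<dots> = (\<Sum>h\<leftarrow>hs. h \<psi>)"
      by (simp add: sum_list_sum_nth atLeast0LessThan sum.atLeast1_atMost_eq hs)
    finally show "\<exists>\<psi>\<in>topspace ?S. 0 \<le> (\<Sum>h\<leftarrow>hs. h \<psi>)"
      using \<psi>(1) by (intro bexI[of _ \<psi>]) (simp_all add: D.topspace_weak_star_ball)
  qed
  then obtain \<mu> where \<mu>: "prob_space \<mu>" "sets \<mu> = sets (borel_algebra ?S)"
    and H: "\<And>h. h \<in> H \<Longrightarrow> 0 \<le> (\<integral>\<psi>. h \<psi> \<partial>\<mu>)"
    by blast
  interpret \<mu>: prob_space \<mu> by (rule \<mu>(1))
  have "cmod (app \<phi> x) \<le> C * nrm_prod x * (\<integral>\<psi>. cmod (\<psi> \<phi>) powr q \<partial>\<mu>) powr (1 / q)"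
    if x: "point x" and \<phi>: "\<phi> \<in> carrier (dual K Y)" for x \<phi>
  proof (cases "nrm_prod x = 0")
    case True
    then show ?thesis by (simp only: app_eq_0[OF \<phi> x]) simp
  next
    case False
    then have s: "0 < nrm_prod x" using nrm_prod_nonneg[OF x] by (rule order.not_eq_order_implies_strict[OF not_sym])
    let ?I = "\<integral>\<psi>. cmod (\<psi> \<phi>) powr q \<partial>\<mu>"
    define t where "t = 1 / nrm_prod x"
    have "0 \<le> 1 / a" "1 / a * a = 1" if "0 < a" for a :: real using that by auto
    from this[OF s] have t: "0 \<le> t" "t * nrm_prod x = 1" unfolding t_def .
    from balanced_rescaling[OF x t(1)] obtain x' where x': "point x'"
      "\<And>j. j \<in> {1..n} \<Longrightarrow> nrm (X j) (x' j) = 1"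
      "app \<phi> x' = complex_of_real t * app \<phi> x"
      unfolding t(2) using \<phi> by auto
    have "nrm_prod x' = 1" using x'(2) by simp
    then have "(1, \<phi>, x') \<in> Z" using \<phi> x'(1) by (simp add: Z_def)
    then have "?h 1 \<phi> x' \<in> H" unfolding H_def by (intro image_eqI[of _ _ "(1, \<phi>, x')"]) auto
    then have "0 \<le> (\<integral>\<psi>. ?h 1 \<phi> x' \<psi> \<partial>\<mu>)" by (rule H)
    also have "\<dots> = C powr q * ?I - cmod (app \<phi> x') powr q"
    proof -
      have "integrable \<mu> (\<lambda>\<psi>. cmod (\<psi> \<phi>) powr q)"
        using q1 by (intro integrable_continuous_map_compact[OF \<mu> D.compact_weak_star_ball]
            D.continuous_map_powr_eval \<phi>) auto
      then show ?thesis by (simp add: \<mu>.prob_space)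
    qed
    finally have "cmod (app \<phi> x') powr q \<le> C powr q * ?I" by simp
    then have "(cmod (app \<phi> x') powr q) powr (1 / q) \<le> (C powr q * ?I) powr (1 / q)"
      using q1 by (intro powr_mono2) auto
    then have "cmod (app \<phi> x') \<le> C * ?I powr (1 / q)"
      using q1 C(1) by (simp add: powr_powr powr_mult)
    then have "t * cmod (app \<phi> x) \<le> C * ?I powr (1 / q)"
      unfolding x'(3) norm_mult norm_of_real abs_of_nonneg[OF t(1)] .
    then have "nrm_prod x * (t * cmod (app \<phi> x)) \<le> nrm_prod x * (C * ?I powr (1 / q))"
      by (rule mult_left_mono) (rule less_imp_le[OF s])
    moreover have "nrm_prod x * (t * cmod (app \<phi> x)) = (t * nrm_prod x) * cmod (app \<phi> x)" by (simp only: ac_simps)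
    ultimately show ?thesis unfolding t(2) by (simp only: ac_simps mult_1)
  qed
  then show ?thesis using \<mu> unfolding dominated_by_def point_def by blast
qed

end

theorem theorem3p8:
  fixes K :: "complex set" and p q :: real and n :: nat
    and X :: "nat \<Rightarrow> 'a normed_module" and Y :: "'b normed_module"
    and T :: "(nat \<Rightarrow> 'a) \<Rightarrow> 'b"
  assumes "K = \<real> \<or> K = UNIV"
    and "1 < p" and "1 / p + 1 / q = 1"
    and "1 \<le> n"
    and "\<And>j. j \<in> {1..n} \<Longrightarrow> banach_space K (X j)"
    and "banach_space K Y"
    and "continuous_multilinear K n X Y T"
  shows
   "let
      cond_i = (\<exists>C>0. \<forall>(m::nat) x \<phi>.
             (\<forall>i\<in>{1..m}. \<forall>j\<in>{1..n}. x i j \<in> carrier (X j)) \<longrightarrow>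
             (\<forall>i\<in>{1..m}. \<phi> i \<in> carrier (dual K Y)) \<longrightarrow>
             (\<Sum>i=1..m. cmod (\<phi> i (T (\<lambda>j\<in>{1..n}. x i j))))
               \<le> C * (\<Sum>i=1..m. \<Prod>j=1..n. nrm (X j) (x i j) powr p) powr (1 / p)
                   * weak_norm K Y q m \<phi>);
      cond_ii = (\<exists>C>0. \<forall>(m::nat) x \<phi>.
             (\<forall>i\<in>{1..m}. \<forall>j\<in>{1..n}. x i j \<in> carrier (X j)) \<longrightarrow>
             (\<forall>i\<in>{1..m}. \<phi> i \<in> carrier (dual K Y)) \<longrightarrow>
             (\<Sum>i=1..m. cmod (\<phi> i (T (\<lambda>j\<in>{1..n}. x i j))))
               \<le> C * (\<Prod>j=1..n. (\<Sum>i=1..m. nrm (X j) (x i j) powr (n * p)) powr (1 / (n * p)))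
                   * weak_norm K Y q m \<phi>);
      cond_iii = (\<exists>C>0. \<exists>\<mu>.
             prob_space \<mu> \<and> sets \<mu> = sets (borel_algebra (weak_star_ball K (dual K Y))) \<and>
             (\<forall>x \<phi>. (\<forall>j\<in>{1..n}. x j \<in> carrier (X j)) \<longrightarrow> \<phi> \<in> carrier (dual K Y) \<longrightarrow>
               cmod (\<phi> (T (\<lambda>j\<in>{1..n}. x j)))
                 \<le> C * (\<Prod>j=1..n. nrm (X j) (x j))
                     * (\<integral>\<psi>. cmod (\<psi> \<phi>) powr q \<partial>\<mu>) powr (1 / q)))
    in (cond_i \<longleftrightarrow> cond_ii) \<and> (cond_ii \<longleftrightarrow> cond_iii)"
proof -
  have RC: "normed_space_RC K V" if "banach_space K V" for V :: "'v normed_module"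
    using that assms(1) by (simp add: normed_space_RC_def normed_space_RC_axioms_def banach_space_def)
  interpret multilinear_operator K Y n X T
  proof (intro multilinear_operator.intro multilinear_operator_axioms.intro)
    show "linear_map K (X j) Y (\<lambda>v. T (x(j := v)))"
      if "x \<in> (\<Pi>\<^sub>E j\<in>{1..n}. carrier (X j))" "j \<in> {1..n}" for x j
      using assms(7) that by (simp add: continuous_multilinear_def)
  qed (use assms RC in auto)
  note p = assms(2) and q = assms(3)
  have i_ii: "(\<exists>C>0. product_summing p q C) \<longleftrightarrow> (\<exists>C>0. factorwise_summing p q C)"
    using product_summing_imp_factorwise_summing[OF p q] factorwise_summing_imp_product_summing[OF p]
    by blast
  have i_iii: "(\<exists>C>0. product_summing p q C) \<longleftrightarrow> (\<exists>C>0. \<exists>\<mu>. dominated_by q C \<mu>)"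
    using product_summing_imp_dominated[OF p q] dominated_imp_product_summing[OF p q] by blast
  show ?thesis
    using conjI[OF i_ii trans[OF i_ii[symmetric] i_iii]]
    unfolding Let_def product_summing_def factorwise_summing_def dominated_by_def .
qed

end
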